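(* Let $\eta^2=-3$ and let $X_\eta=\{a^4+a^2e_2(u_1,\dots,u_5)+e_4(u_1,\dots,u_5)=0\}$ in the hyperplane $L_\eta:\ u_1+\cdots+u_5=\eta a$ of $\mathbb{P}^5$. The incidences between the forty-five nodes $R_{A,B;c}$, $T_C$, $E_c$ of $X_\eta$ and the twenty Pascal planes $\Pi_{ij}$ ($i\ne j$) are as follows: there are $30$ nodes of type $R_{A,B;c}$ and each lies on exactly $4$ Pascal planes; there are $10$ nodes of type $T_C$ and each lies on exactly $6$ Pascal planes; there are $5$ nodes of type $E_c$ and each lies on $0$ Pascal planes. In particular, each Pascal plane contains exactly nine of the nodes.
   Context: We work over $\mathbb{C}$; $e_r$ is the elementary symmetric polynomial of degree $r$, and $a,u_1,\dots,u_5$ are homogeneous coordinates on $\mathbb{P}^5$. For $i\neq j$ in $\{1,\dots,5\}$ the Pascal plane $\Pi_{ij}\subset L_\eta$ is given by $a+u_i=0$, $a-u_j=0$. The forty-five nodes (ordinary double points, the only singular points) of $X_\eta$ are the following points $[a:u_1:\dots:u_5]$ of $L_\eta$. (i) For a partition $\{1,\dots,5\}=A\sqcup B\sqcup\{c\}$ with $|A|=|B|=2$ (where $A,B$ are distinguished), $R_{A,B;c}$ is the point with $a=1$, $u_i=-1$ for $i\in A$, $u_j=1$ for $j\in B$, $u_c=\eta$. (ii) For a two-element subset $C=\{p,q\}\subset\{1,\dots,5\}$, $T_C$ is the point with $a=0$, $u_i=0$ for $i\notin C$, $u_p=1$, $u_q=-1$ (projectively independent of the order of $p,q$). (iii) For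 $c\in\{1,\dots,5\}$, $E_c$ is the point with $a=1$, $u_c=-\eta/3$, $u_i=\eta/3$ for $i\neq c$. *)

theory Defs
  imports "HOL-Analysis.Analysis"
begin

text \<open>
  Homogeneous coordinates on the complex projective 5-space are indexed by \<open>5 option\<close>:
  \<open>v $ None\<close> is the coordinate $a$, and \<open>v $ Some i\<close> is $u_i$, where the five-element type \<open>5\<close>
  serves as the index set $1,\dots,5$ (its element \<open>5\<close> is also written \<open>0\<close>).
  A point of projective space is a complex line \<open>vec.span {v}\<close> with \<open>v \<noteq> 0\<close>.
\<close>

type_synonym coords = "complex ^ (5 option)"

definition hcoords :: "complex \<Rightarrow> (5 \<Rightarrow> complex) \<Rightarrow> coords" where
  "hcoords a u = (\<chi> k. case k of None \<Rightarrow> a | Some i \<Rightarrow> u i)"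

definition proj_point :: "coords \<Rightarrow> coords set" where
  "proj_point v = vec.span {v}"

text \<open>\<open>P\<close> is meant to be invariant under nonzero scaling.\<close>

definition proj_locus :: "(coords \<Rightarrow> bool) \<Rightarrow> coords set set" where
  "proj_locus P = {proj_point v | v. v \<noteq> 0 \<and> P v}"

definition elem_sym :: "nat \<Rightarrow> (5 \<Rightarrow> complex) \<Rightarrow> complex" where
  "elem_sym r u = (\<Sum>S | card S = r. \<Prod>i\<in>S. u i)"

definition quartic :: "coords \<Rightarrow> complex" where
  "quartic v = (let a = v $ None; u = (\<lambda>i. v $ Some i)
     in a ^ 4 + a ^ 2 * elem_sym 2 u + elem_sym 4 u)"

definition hyperplane :: "complex \<Rightarrow> coords set" where
  "hyperplane \<eta> = {v. (\<Sum>i\<in>UNIV. v $ Some i) = \<eta> * v $ None}"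

definition X_eta :: "complex \<Rightarrow> coords set set" where
  "X_eta \<eta> = proj_locus (\<lambda>v. v \<in> hyperplane \<eta> \<and> quartic v = 0)"

definition dir_deriv :: "(coords \<Rightarrow> complex) \<Rightarrow> coords \<Rightarrow> coords \<Rightarrow> complex" where
  "dir_deriv F v x = deriv (\<lambda>t. F (v + t *s x)) 0"

definition hessian :: "(coords \<Rightarrow> complex) \<Rightarrow> coords \<Rightarrow> coords \<Rightarrow> coords \<Rightarrow> complex" where
  "hessian F v x y = deriv (\<lambda>s. dir_deriv F (v + s *s x) y) 0"

text \<open>
  \<open>v\<close> represents an ordinary double point of the hypersurface \<open>F = 0\<close> in the projective space of
  the linear subspace \<open>L\<close>. Near this point, in the affine chart where the \<open>k\<close>-th coordinate
  does not vanish, the points of that space are represented by the vectors \<open>v + w\<close> with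
  \<open>w \<in> L\<close>, \<open>w $ k = 0\<close>, and \<open>F (v + w) = 0\<close> is a local equation of the hypersurface.
  It must have a critical point with nondegenerate Hessian at \<open>w = 0\<close>. For homogeneous \<open>F\<close>
  the choice of the chart does not matter.
\<close>

definition ordinary_double_point ::
    "(coords \<Rightarrow> complex) \<Rightarrow> coords set \<Rightarrow> coords \<Rightarrow> bool" where
  "ordinary_double_point F L v \<longleftrightarrow> v \<in> L \<and> F v = 0 \<and>
     (\<exists>k. v $ k \<noteq> 0 \<and>
       (let W = {w \<in> L. w $ k = 0} in
         (\<forall>x\<in>W. dir_deriv F v x = 0) \<and>
         (\<forall>x\<in>W. (\<forall>y\<in>W. hessian F v x y = 0) \<longrightarrow> x = 0)))"

definition nodes :: "complex \<Rightarrow> coords set set" where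
  "nodes \<eta> = proj_locus (ordinary_double_point quartic (hyperplane \<eta>))"

text \<open>The index outside \<open>A \<union> B\<close> is the one called $c$ in $R_{A,B;c}$.\<close>

definition R_point :: "complex \<Rightarrow> 5 set \<Rightarrow> 5 set \<Rightarrow> coords set" where
  "R_point \<eta> A B =
     proj_point (hcoords 1 (\<lambda>i. if i \<in> A then -1 else if i \<in> B then 1 else \<eta>))"

definition R_nodes :: "complex \<Rightarrow> coords set set" where
  "R_nodes \<eta> = {R_point \<eta> A B | A B c.
     card A = 2 \<and> card B = 2 \<and> A \<inter> B = {} \<and> c \<notin> A \<union> B \<and> A \<union> B \<union> {c} = UNIV}"

text \<open>The point $T_C$ for $C$ consisting of \<open>p\<close> and \<open>q\<close>; exchanging \<open>p\<close> and \<open>q\<close> negates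
  the coordinate vector and gives the same point.\<close>

definition T_point :: "5 \<Rightarrow> 5 \<Rightarrow> coords set" where
  "T_point p q = proj_point (hcoords 0 (\<lambda>i. if i = p then 1 else if i = q then -1 else 0))"

definition T_nodes :: "coords set set" where
  "T_nodes = {T_point p q | p q. p \<noteq> q}"

definition E_point :: "complex \<Rightarrow> 5 \<Rightarrow> coords set" where
  "E_point \<eta> c = proj_point (hcoords 1 (\<lambda>i. if i = c then - \<eta> / 3 else \<eta> / 3))"

definition E_nodes :: "complex \<Rightarrow> coords set set" where
  "E_nodes \<eta> = range (E_point \<eta>)"

definition pascal_plane :: "complex \<Rightarrow> 5 \<Rightarrow> 5 \<Rightarrow> coords set set" where
  "pascal_plane \<eta> i j = proj_locus (\<lambda>v. v \<in> hyperplane \<eta> \<and>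
     v $ None + v $ Some i = 0 \<and> v $ None - v $ Some j = 0)"

definition pascal_planes :: "complex \<Rightarrow> coords set set set" where
  "pascal_planes \<eta> = {pascal_plane \<eta> i j | i j. i \<noteq> j}"

end

theory Submission
  imports Defs
begin

text \<open>
  Newton's identities turn the quartic, restricted to the hyperplane $\sum_i u_i = \eta a$, into a
  polynomial in $a$ and the power sums of the $u_i$. Its gradient vanishes along the hyperplane iff
  all five $u_i$ are roots of one cubic whose coefficients involve only $a$ and the power sums. So
  $u$ takes at most three values, and if it takes three, they sum to $\eta a$. Running through the
  multiplicities, $2+2+1$ gives the points $R_{A,B;c}$, $3+1+1$ the points $T_C$, $4+1$ the points
  $E_c$, and $3+2$ and $5$ give nothing. At each of these points the radical of the Hessian is
  computed by testing against vectors that are supported on few coordinates.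
\<close>

section \<open>Power sums and derivatives of the quartic\<close>

text \<open>The power sum form agrees with \<open>quartic\<close> only on the hyperplane, so all
  derivatives are taken along lines \<open>v + t *s x\<close> that stay inside it. The definition of
  an ordinary double point tests only directions with \<open>x $ k = 0\<close>; Euler's relation and
  \<open>quartic v = 0\<close> supply the missing direction \<open>v\<close>, which makes the
  critical point condition independent of the chart.

  The coefficients of the cubic contain power sums of its own roots, so each multiplicity pattern is
  a self-consistency problem. For three values, Vieta gives their plain sum and the hyperplane gives
  the sum weighted by multiplicities; comparing the two is linear. For two values the third root of
  the cubic is unknown, so besides the divided difference the cubic itself has to be evaluated.

  The Hessian is a diagonal form plus products of three linear forms: \<open>x $ None\<close> and
  the sums of \<open>x $ Some i\<close> weighted by \<open>v $ Some i\<close> and by its square.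
  This forces a vector of the radical to be constant where \<open>v\<close> is, away from the
  coordinate that defines the chart, and leaves a small linear system. The relation
  \<open>\<eta> ^ 2 = -3\<close> makes that system nonsingular.\<close>

lemma esym_insert:
  fixes u :: "'i \<Rightarrow> 'a::comm_semiring_1"
  assumes "finite A" "x \<notin> A"
  shows "(\<Sum>S | S \<subseteq> insert x A \<and> card S = Suc r. \<Prod>i\<in>S. u i) =
    (\<Sum>S | S \<subseteq> A \<and> card S = Suc r. \<Prod>i\<in>S. u i) +
    u x * (\<Sum>S | S \<subseteq> A \<and> card S = r. \<Prod>i\<in>S. u i)"
proof -
  let ?P = "\<lambda>A r. {S. S \<subseteq> A \<and> card S = r}"
  have fin: "finite S" if "S \<subseteq> A" for S
    using that assms(1) finite_subset by blast
  have split: "?P (insert x A) (Suc r) = ?P A (Suc r) \<union> insert x ` ?P A r" (is "?L = ?R")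
  proof
    show "?L \<subseteq> ?R"
    proof
      fix S assume S: "S \<in> ?L"
      show "S \<in> ?R"
      proof (cases "x \<in> S")
        case True
        then have "S = insert x (S - {x})" "S - {x} \<subseteq> A" "card (S - {x}) = r"
          using S by auto
        then show ?thesis by blast
      qed (use S in auto)
    qed
    show "?R \<subseteq> ?L"
      using assms fin by (auto simp: card_insert_if)
  qed
  have inj: "inj_on (insert x) (?P A r)"
    using assms(2) by (auto simp: inj_on_def dest!: insert_ident[THEN iffD1, rotated 2])
  have "(\<Sum>S\<in>?P (insert x A) (Suc r). \<Prod>i\<in>S. u i) =
      (\<Sum>S\<in>?P A (Suc r). \<Prod>i\<in>S. u i) + (\<Sum>S\<in>insert x ` ?P A r. \<Prod>i\<in>S. u i)"
    unfolding split using assms by (intro sum.union_disjoint) auto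
  also have "(\<Sum>S\<in>insert x ` ?P A r. \<Prod>i\<in>S. u i) = (\<Sum>S\<in>?P A r. u x * (\<Prod>i\<in>S. u i))"
    using assms fin by (subst sum.reindex[OF inj]) (auto intro!: sum.cong prod.insert)
  finally show ?thesis by (simp add: sum_distrib_left)
qed

lemma esym_0:
  fixes u :: "'i \<Rightarrow> 'a::comm_semiring_1"
  assumes "finite A"
  shows "(\<Sum>S | S \<subseteq> A \<and> card S = 0. \<Prod>i\<in>S. u i) = 1"
proof -
  have "{S. S \<subseteq> A \<and> card S = 0} = {{}}"
    using assms by (auto dest: finite_subset)
  then show ?thesis by simp
qed

text \<open>Proved for an arbitrary finite index set so that induction on the set applies. The case
  \<open>e 3\<close> feeds the induction step of \<open>e 4\<close>.\<close>

lemma newton_identities: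
  fixes u :: "'i \<Rightarrow> 'a::field_char_0"
  assumes "finite A"
  defines "e \<equiv> \<lambda>r. \<Sum>S | S \<subseteq> A \<and> card S = r. \<Prod>i\<in>S. u i"
    and "p \<equiv> \<lambda>r. \<Sum>i\<in>A. u i ^ r"
  shows "e 1 = p 1" "2 * e 2 = p 1 ^ 2 - p 2" "6 * e 3 = p 1 ^ 3 - 3 * p 1 * p 2 + 2 * p 3"
    "24 * e 4 = p 1 ^ 4 - 6 * p 1 ^ 2 * p 2 + 3 * p 2 ^ 2 + 8 * p 1 * p 3 - 6 * p 4"
proof -
  define E where "E = (\<lambda>r A. \<Sum>S | S \<subseteq> A \<and> card S = r. \<Prod>i\<in>S. u i)"
  define P where "P = (\<lambda>r A. \<Sum>i\<in>A. u i ^ r)"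
  have E0: "E 0 A = 1" if "finite A" for A
    unfolding E_def using esym_0[OF that] .
  have E_empty: "E (Suc r) {} = 0" for r
    unfolding E_def by (rule sum.neutral) auto
  have E_insert: "E (Suc r) (insert x A) = E (Suc r) A + u x * E r A" if "finite A" "x \<notin> A" for r x A
    unfolding E_def by (rule esym_insert[OF that])
  have P_insert: "P r (insert x A) = u x ^ r + P r A" if "finite A" "x \<notin> A" for r x A
    unfolding P_def using that by simp
  have P_empty: "P r {} = 0" for r by (simp add: P_def)
  have "E 1 A = P 1 A \<and> 2 * E 2 A = P 1 A ^ 2 - P 2 A \<and>
    6 * E 3 A = P 1 A ^ 3 - 3 * P 1 A * P 2 A + 2 * P 3 A \<and>
    24 * E 4 A = P 1 A ^ 4 - 6 * P 1 A ^ 2 * P 2 A + 3 * P 2 A ^ 2 + 8 * P 1 A * P 3 A - 6 * P 4 A"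
    using assms(1)
  proof (induction A)
    case empty
    then show ?case
      using E_empty[of 0] E_empty[of 1] E_empty[of 2] E_empty[of 3]
      by (simp add: P_empty numeral_eq_Suc)
  next
    case (insert x A)
    have e: "E 1 (insert x A) = E 1 A + u x" "E 2 (insert x A) = E 2 A + u x * E 1 A"
      "E 3 (insert x A) = E 3 A + u x * E 2 A" "E 4 (insert x A) = E 4 A + u x * E 3 A"
      using E_insert[OF insert(1,2), of 0] E_insert[OF insert(1,2), of 1]
        E_insert[OF insert(1,2), of 2] E_insert[OF insert(1,2), of 3] E0[OF insert(1)]
      by (simp_all add: numeral_eq_Suc)
    from insert(3) have IH: "E 1 A = P 1 A" "2 * E 2 A = P 1 A ^ 2 - P 2 A"
      "6 * E 3 A = P 1 A ^ 3 - 3 * P 1 A * P 2 A + 2 * P 3 A"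
      "24 * E 4 A = P 1 A ^ 4 - 6 * P 1 A ^ 2 * P 2 A + 3 * P 2 A ^ 2 + 8 * P 1 A * P 3 A - 6 * P 4 A"
      by auto
    \<comment> \<open>The products are regrouped so that the left sides of the induction hypotheses
      appear literally and can be rewritten.\<close>
    have "2 * (E 2 A + u x * E 1 A) = 2 * E 2 A + 2 * u x * E 1 A"
      "6 * (E 3 A + u x * E 2 A) = 6 * E 3 A + 3 * u x * (2 * E 2 A)"
      "24 * (E 4 A + u x * E 3 A) = 24 * E 4 A + 4 * u x * (6 * E 3 A)"
      by (simp_all add: algebra_simps)
    then show ?case
      unfolding e P_insert[OF insert(1,2)] IH
      by (simp add: algebra_simps power2_eq_square power3_eq_cube power4_eq_xxxx)
  qed
  then show "e 1 = p 1" "2 * e 2 = p 1 ^ 2 - p 2" "6 * e 3 = p 1 ^ 3 - 3 * p 1 * p 2 + 2 * p 3"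
    "24 * e 4 = p 1 ^ 4 - 6 * p 1 ^ 2 * p 2 + 3 * p 2 ^ 2 + 8 * p 1 * p 3 - 6 * p 4"
    unfolding e_def p_def E_def P_def by auto
qed

section \<open>The quartic on the hyperplane and its first two derivatives\<close>

definition psum :: "nat \<Rightarrow> coords \<Rightarrow> complex" where
  "psum r v = (\<Sum>i\<in>UNIV. v $ Some i ^ r)"

text \<open>On the hyperplane the first power sum is \<open>\<eta> * a\<close>, so its square is
  \<open>-3 * a ^ 2\<close> and its fourth power \<open>9 * a ^ 4\<close>; \<open>\<eta>\<close>
  itself survives only in the term with \<open>psum 3 v\<close>.\<close>

lemma quartic_on_hyperplane:
  assumes "\<eta> ^ 2 = -3" "v \<in> hyperplane \<eta>"
  shows "quartic v = - (v $ None ^ 4) / 8 + v $ None ^ 2 * psum 2 v / 4 + psum 2 v ^ 2 / 8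
    + \<eta> / 3 * v $ None * psum 3 v - psum 4 v / 4"
proof -
  define a where "a = v $ None"
  define u where "u = (\<lambda>i. v $ Some i)"
  have p1: "(\<Sum>i\<in>UNIV. u i) = \<eta> * a"
    using assms(2) by (simp add: hyperplane_def a_def u_def)
  have e: "elem_sym r u = (\<Sum>S | S \<subseteq> UNIV \<and> card S = r. \<Prod>i\<in>S. u i)" for r
    by (simp add: elem_sym_def)
  have p: "psum r v = (\<Sum>i\<in>UNIV. u i ^ r)" for r
    by (simp add: psum_def u_def)
  note n = newton_identities[of UNIV u, folded e p, simplified]
  have p1': "psum (Suc 0) v = \<eta> * a" by (simp add: p p1)
  have e2: "elem_sym 2 u = (psum 1 v ^ 2 - psum 2 v) / 2"
    and e4: "elem_sym 4 u = (psum 1 v ^ 4 - 6 * psum 1 v ^ 2 * psum 2 v + 3 * psum 2 v ^ 2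
      + 8 * psum 1 v * psum 3 v - 6 * psum 4 v) / 24"
    using n(2,4) by (simp_all add: field_simps)
  have P2: "psum 1 v ^ 2 = -3 * a ^ 2" and P4: "psum 1 v ^ 4 = 9 * a ^ 4"
    using assms(1) power_mult[of \<eta> 2 2] by (simp_all add: p1' power_mult_distrib)
  have "a ^ 4 + a ^ 2 * elem_sym 2 u + elem_sym 4 u =
    - (a ^ 4) / 8 + a ^ 2 * psum 2 v / 4 + psum 2 v ^ 2 / 8
    + \<eta> / 3 * a * psum 3 v - psum 4 v / 4"
    unfolding e2 e4 P2 P4 by (simp add: p1' field_simps power2_eq_square power4_eq_xxxx)
  then show ?thesis by (simp add: quartic_def Let_def a_def u_def)
qed

text \<open>The formal derivative of the power sum expression in
  \<open>quartic_on_hyperplane\<close>, not of \<open>quartic\<close>; the two agree for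
  \<open>v\<close> and \<open>x\<close> in the hyperplane.\<close>

definition quartic_grad :: "complex \<Rightarrow> coords \<Rightarrow> coords \<Rightarrow> complex" where
  "quartic_grad \<eta> v x =
     (- (v $ None ^ 3) / 2 + v $ None * psum 2 v / 2 + \<eta> / 3 * psum 3 v) * x $ None +
     (\<Sum>i\<in>UNIV. ((v $ None ^ 2 + psum 2 v) / 2 * v $ Some i + \<eta> * v $ None * v $ Some i ^ 2
        - v $ Some i ^ 3) * x $ Some i)"

lemma hyperplane_add: "v \<in> hyperplane \<eta> \<Longrightarrow> x \<in> hyperplane \<eta> \<Longrightarrow> v + t *s x \<in> hyperplane \<eta>"
  by (simp add: hyperplane_def sum.distrib sum_distrib_left[symmetric] algebra_simps)

lemma mult_power_pred: "0 < n \<Longrightarrow> z * z ^ (n - Suc 0) = (z::'a::monoid_mult) ^ n"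
  by (cases n) auto

lemma dir_deriv_quartic:
  assumes "\<eta> ^ 2 = -3" "v \<in> hyperplane \<eta>" "x \<in> hyperplane \<eta>"
  shows "dir_deriv quartic v x = quartic_grad \<eta> v x"
proof -
  define s where "s = (\<lambda>r. \<Sum>i\<in>UNIV. v $ Some i ^ r * x $ Some i)"
  have psum: "((\<lambda>t. psum (Suc r) (v + t *s x)) has_field_derivative of_nat (Suc r) * s r) (at 0)" for r
    unfolding psum_def s_def
    by (cases r) (auto intro!: derivative_eq_intros sum.cong
        simp: sum_distrib_left algebra_simps mult_power_pred)
  have ps: "((\<lambda>t. psum 2 (v + t *s x)) has_field_derivative 2 * s 1) (at 0)"
     "((\<lambda>t. psum 3 (v + t *s x)) has_field_derivative 3 * s 2) (at 0)"
     "((\<lambda>t. psum 4 (v + t *s x)) has_field_derivative 4 * s 3) (at 0)"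
    using psum[of 1] psum[of 2] psum[of 3] by (simp_all add: numeral_eq_Suc)
  have grad: "quartic_grad \<eta> v x =
     (- (v $ None ^ 3) / 2 + v $ None * psum 2 v / 2 + \<eta> / 3 * psum 3 v) * x $ None +
     (v $ None ^ 2 + psum 2 v) / 2 * s 1 + \<eta> * v $ None * s 2 - s 3"
    by (simp add: quartic_grad_def s_def sum.distrib sum_subtractf sum_distrib_left algebra_simps add_divide_distrib)
  have "((\<lambda>t. quartic (v + t *s x)) has_field_derivative quartic_grad \<eta> v x) (at 0)"
    unfolding quartic_on_hyperplane[OF assms(1) hyperplane_add[OF assms(2,3)]] grad
    by (rule derivative_eq_intros ps refl | simp)+ (simp add: field_simps power2_eq_square power3_eq_cube)
  then show ?thesis
    unfolding dir_deriv_def by (rule DERIV_imp_deriv)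
qed

text \<open>The derivative of \<open>quartic_grad \<eta> v y\<close> in direction \<open>x\<close>,
  sorted so that the symmetry in \<open>x\<close> and \<open>y\<close> is visible.\<close>

definition quartic_hess :: "complex \<Rightarrow> coords \<Rightarrow> coords \<Rightarrow> coords \<Rightarrow> complex" where
  "quartic_hess \<eta> v x y =
     (psum 2 v - 3 * v $ None ^ 2) / 2 * x $ None * y $ None +
     v $ None * (x $ None * (\<Sum>i\<in>UNIV. v $ Some i * y $ Some i) + y $ None * (\<Sum>i\<in>UNIV. v $ Some i * x $ Some i)) +
     \<eta> * (x $ None * (\<Sum>i\<in>UNIV. v $ Some i ^ 2 * y $ Some i) + y $ None * (\<Sum>i\<in>UNIV. v $ Some i ^ 2 * x $ Some i)) +
     (\<Sum>i\<in>UNIV. v $ Some i * x $ Some i) * (\<Sum>i\<in>UNIV. v $ Some i * y $ Some i) +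
     (\<Sum>i\<in>UNIV. ((v $ None ^ 2 + psum 2 v) / 2 + 2 * \<eta> * v $ None * v $ Some i
        - 3 * v $ Some i ^ 2) * x $ Some i * y $ Some i)"

lemma hessian_quartic:
  assumes "\<eta> ^ 2 = -3" "v \<in> hyperplane \<eta>" "x \<in> hyperplane \<eta>" "y \<in> hyperplane \<eta>"
  shows "hessian quartic v x y = quartic_hess \<eta> v x y"
proof -
  define s where "s = (\<lambda>r. \<Sum>i\<in>UNIV. v $ Some i ^ r * x $ Some i)"
  define q where "q = (\<lambda>r v. \<Sum>i\<in>UNIV. v $ Some i ^ r * y $ Some i)"
  define w where "w = (\<lambda>r. \<Sum>i\<in>UNIV. v $ Some i ^ r * x $ Some i * y $ Some i)"
  have psum: "((\<lambda>t. psum (Suc r) (v + t *s x)) has_field_derivative of_nat (Suc r) * s r) (at 0)" for r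
    unfolding psum_def s_def
    by (cases r) (auto intro!: derivative_eq_intros sum.cong
        simp: sum_distrib_left algebra_simps mult_power_pred)
  have qsum: "((\<lambda>t. q (Suc r) (v + t *s x)) has_field_derivative of_nat (Suc r) * w r) (at 0)" for r
    unfolding q_def w_def
    by (cases r) (auto intro!: derivative_eq_intros sum.cong
        simp: sum_distrib_left algebra_simps mult_power_pred)
  have ps: "((\<lambda>t. psum 2 (v + t *s x)) has_field_derivative 2 * s 1) (at 0)"
     "((\<lambda>t. psum 3 (v + t *s x)) has_field_derivative 3 * s 2) (at 0)"
     "((\<lambda>t. q 1 (v + t *s x)) has_field_derivative w 0) (at 0)"
     "((\<lambda>t. q 2 (v + t *s x)) has_field_derivative 2 * w 1) (at 0)"
     "((\<lambda>t. q 3 (v + t *s x)) has_field_derivative 3 * w 2) (at 0)"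
    using psum[of 1] psum[of 2] qsum[of 0] qsum[of 1] qsum[of 2] by (simp_all add: numeral_eq_Suc)
  have grad: "quartic_grad \<eta> v y =
     (- (v $ None ^ 3) / 2 + v $ None * psum 2 v / 2 + \<eta> / 3 * psum 3 v) * y $ None +
     (v $ None ^ 2 + psum 2 v) / 2 * q 1 v + \<eta> * v $ None * q 2 v - q 3 v" for v
    by (simp add: quartic_grad_def q_def sum.distrib sum_subtractf sum_distrib_left algebra_simps add_divide_distrib)
  have "(\<Sum>i\<in>UNIV. ((v $ None ^ 2 + psum 2 v) / 2 + 2 * \<eta> * v $ None * v $ Some i
        - 3 * v $ Some i ^ 2) * x $ Some i * y $ Some i) =
      (v $ None ^ 2 + psum 2 v) / 2 * w 0 + 2 * \<eta> * v $ None * w 1 - 3 * w 2"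
    by (simp add: w_def sum.distrib sum_subtractf sum_distrib_left algebra_simps add_divide_distrib)
  then have hess: "quartic_hess \<eta> v x y =
     (psum 2 v - 3 * v $ None ^ 2) / 2 * x $ None * y $ None +
     v $ None * (x $ None * q 1 v + y $ None * s 1) + \<eta> * (x $ None * q 2 v + y $ None * s 2) +
     s 1 * q 1 v + ((v $ None ^ 2 + psum 2 v) / 2 * w 0 + 2 * \<eta> * v $ None * w 1 - 3 * w 2)"
    by (simp add: quartic_hess_def s_def q_def)
  have "((\<lambda>t. quartic_grad \<eta> (v + t *s x) y) has_field_derivative quartic_hess \<eta> v x y) (at 0)"
    unfolding grad hess
    by (rule derivative_eq_intros ps refl | simp)+ (simp add: field_simps power2_eq_square power3_eq_cube)
  \<comment> \<open>The inner derivative may be replaced at every point of the line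
    \<open>v + s *s x\<close>, because that line stays in the hyperplane.\<close>
  then show ?thesis
    unfolding hessian_def dir_deriv_quartic[OF assms(1) hyperplane_add[OF assms(2,3)] assms(4)]
    by (rule DERIV_imp_deriv)
qed

text \<open>The second form catches a square of \<open>\<eta>\<close> inside a right-nested product,
  as \<open>algebra_simps\<close> produces it.\<close>

lemma eta_mult:
  fixes \<eta> z :: complex
  assumes "\<eta> ^ 2 = -3"
  shows "\<eta> * \<eta> = -3" "\<eta> * (\<eta> * z) = -3 * z"
  using assms by (simp_all add: power2_eq_square flip: mult.assoc)

text \<open>Along the hyperplane the $u_i$-component of the gradient is minus this cubic at $u_i$, up to a
  multiple of the equation of the hyperplane.\<close>

definition node_cubic :: "complex \<Rightarrow> coords \<Rightarrow> complex \<Rightarrow> complex" where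
  "node_cubic \<eta> v z = z ^ 3 - \<eta> * v $ None * z ^ 2 - (v $ None ^ 2 + psum 2 v) / 2 * z
    + \<eta> * (v $ None * psum 2 v - v $ None ^ 3) / 6 - psum 3 v / 3"

text \<open>Elimination of the Lagrange multiplier: as \<open>\<eta> ^ 2 = -3\<close>, the factor
  next to the first bracket is \<open>\<eta> / 3\<close> times the hyperplane equation for
  \<open>x\<close>, and the bracket is the component of the gradient along \<open>a\<close>.\<close>

lemma quartic_grad_cubic:
  assumes "\<eta> ^ 2 = -3"
  shows "quartic_grad \<eta> v x =
    (- (v $ None ^ 3) / 2 + v $ None * psum 2 v / 2 + \<eta> / 3 * psum 3 v) *
      (x $ None + \<eta> / 3 * (\<Sum>i\<in>UNIV. x $ Some i)) -
    (\<Sum>i\<in>UNIV. node_cubic \<eta> v (v $ Some i) * x $ Some i)"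
proof -
  define K where "K = - (v $ None ^ 3) / 2 + v $ None * psum 2 v / 2 + \<eta> / 3 * psum 3 v"
  \<comment> \<open>The constant term of \<open>node_cubic\<close> is designed for this equation: it
    absorbs the multiplier \<open>K\<close>.\<close>
  have K: "\<eta> * (v $ None * psum 2 v - v $ None ^ 3) / 6 - psum 3 v / 3 = \<eta> / 3 * K"
    by (simp add: K_def field_simps eta_mult[OF assms])
  have "quartic_grad \<eta> v x = K * x $ None +
    (\<Sum>i\<in>UNIV. (\<eta> / 3 * K - node_cubic \<eta> v (v $ Some i)) * x $ Some i)"
    unfolding quartic_grad_def K_def[symmetric] node_cubic_def K[symmetric]
    by (intro arg_cong2[of _ _ _ _ "(+)"] sum.cong refl) (simp add: algebra_simps)
  also have "\<dots> = K * x $ None + \<eta> / 3 * K * (\<Sum>i\<in>UNIV. x $ Some i) -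
     (\<Sum>i\<in>UNIV. node_cubic \<eta> v (v $ Some i) * x $ Some i)"
    by (simp add: sum_subtractf sum_distrib_left algebra_simps)
  finally show ?thesis by (simp add: K_def algebra_simps)
qed

lemma quartic_grad_zero_iff:
  assumes "\<eta> ^ 2 = -3"
  shows "(\<forall>x\<in>hyperplane \<eta>. quartic_grad \<eta> v x = 0) \<longleftrightarrow>
    (\<forall>i. node_cubic \<eta> v (v $ Some i) = 0)"
proof
  assume L: "\<forall>x\<in>hyperplane \<eta>. quartic_grad \<eta> v x = 0"
  show "\<forall>i. node_cubic \<eta> v (v $ Some i) = 0"
  proof
    fix i
    \<comment> \<open>A vector of the hyperplane with a single nonzero \<open>u\<close>-coordinate;
      it isolates the cubic at index \<open>i\<close>.\<close>
    define x where "x = hcoords 1 (\<lambda>j. if j = i then \<eta> else 0)"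
    have x: "x $ None = 1" "x $ Some j = (if j = i then \<eta> else 0)" for j
      by (simp_all add: x_def hcoords_def)
    have "x \<in> hyperplane \<eta>" by (simp add: hyperplane_def x)
    then have "quartic_grad \<eta> v x = 0" using L by blast
    moreover have "(\<Sum>j\<in>UNIV. node_cubic \<eta> v (v $ Some j) * (if j = i then \<eta> else 0)) =
        node_cubic \<eta> v (v $ Some i) * \<eta>"
      by (simp add: if_distrib cong: if_cong)
    moreover have "1 + \<eta> / 3 * \<eta> = 0" "\<eta> \<noteq> 0"
      using assms by (auto simp: power2_eq_square)
    ultimately show "node_cubic \<eta> v (v $ Some i) = 0"
      by (simp add: quartic_grad_cubic[OF assms] x)
  qed
next
  assume "\<forall>i. node_cubic \<eta> v (v $ Some i) = 0"
  moreover have "x $ None + \<eta> / 3 * (\<Sum>i\<in>UNIV. x $ Some i) = 0" if "x \<in> hyperplane \<eta>" for x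
    using that by (simp add: hyperplane_def field_simps eta_mult[OF assms])
  ultimately show "\<forall>x\<in>hyperplane \<eta>. quartic_grad \<eta> v x = 0"
    by (simp add: quartic_grad_cubic[OF assms])
qed

text \<open>Euler's relation in degree 4. It exchanges the condition \<open>quartic v = 0\<close>
  for a vanishing derivative in direction \<open>v\<close>.\<close>

lemma quartic_euler:
  assumes "\<eta> ^ 2 = -3" "v \<in> hyperplane \<eta>"
  shows "quartic_grad \<eta> v v = 4 * quartic v"
proof -
  have *: "(\<Sum>i\<in>UNIV. (A * v $ Some i + B * v $ Some i ^ 2 - v $ Some i ^ 3) * v $ Some i) =
     A * psum 2 v + B * psum 3 v - psum 4 v" for A B
    by (simp add: psum_def sum.distrib sum_subtractf sum_distrib_left algebra_simps
        power2_eq_square power3_eq_cube power4_eq_xxxx)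
  show ?thesis
    unfolding quartic_grad_def quartic_on_hyperplane[OF assms] *
    by (simp add: field_simps power2_eq_square power3_eq_cube power4_eq_xxxx)
qed

lemma quartic_grad_linear:
  "quartic_grad \<eta> v (x + t *s y) = quartic_grad \<eta> v x + t * quartic_grad \<eta> v y"
proof -
  have *: "(\<Sum>i\<in>UNIV. f i * (x + t *s y) $ Some i) =
      (\<Sum>i\<in>UNIV. f i * x $ Some i) + t * (\<Sum>i\<in>UNIV. f i * y $ Some i)" for f
    by (simp add: sum.distrib sum_distrib_left algebra_simps)
  show ?thesis
    unfolding quartic_grad_def * by (simp add: algebra_simps add_divide_distrib)
qed

lemma ordinary_double_point_quartic:
  assumes "\<eta> ^ 2 = -3"
  shows "ordinary_double_point quartic (hyperplane \<eta>) v \<longleftrightarrow>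
    v \<in> hyperplane \<eta> \<and> (\<forall>i. node_cubic \<eta> v (v $ Some i) = 0) \<and>
    (\<exists>k. v $ k \<noteq> 0 \<and> (\<forall>x\<in>hyperplane \<eta>. x $ k = 0 \<longrightarrow>
      (\<forall>y\<in>hyperplane \<eta>. y $ k = 0 \<longrightarrow> quartic_hess \<eta> v x y = 0) \<longrightarrow> x = 0))"
proof (cases "v \<in> hyperplane \<eta>")
  case True
  have "(quartic v = 0 \<and> (\<forall>x\<in>hyperplane \<eta>. x $ k = 0 \<longrightarrow> quartic_grad \<eta> v x = 0)) \<longleftrightarrow>
      (\<forall>i. node_cubic \<eta> v (v $ Some i) = 0)" (is "?l \<longleftrightarrow> ?r") if k: "v $ k \<noteq> 0" for k
  proof
    assume l: ?l
    have "quartic_grad \<eta> v x = 0" if x: "x \<in> hyperplane \<eta>" for x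
    proof -
      \<comment> \<open>This multiple of \<open>v\<close> moves \<open>x\<close> into the directions
        with vanishing \<open>k\<close>-th coordinate, the only ones that the chart tests.\<close>
      define t where "t = - (x $ k / v $ k)"
      have "quartic_grad \<eta> v (x + t *s v) = 0"
        using l k hyperplane_add[OF x True, of t] by (auto simp: t_def)
      then show ?thesis
        using l by (simp add: quartic_grad_linear quartic_euler[OF assms True])
    qed
    then show ?r using quartic_grad_zero_iff[OF assms] by blast
  next
    assume ?r
    then have "\<forall>x\<in>hyperplane \<eta>. quartic_grad \<eta> v x = 0"
      using quartic_grad_zero_iff[OF assms] by blast
    then show ?l using quartic_euler[OF assms True] True by auto
  qed
  then show ?thesis
    using True hessian_quartic[OF assms True] dir_deriv_quartic[OF assms True]
    unfolding ordinary_double_point_def by (auto simp: Let_def) blast+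
qed (simp add: ordinary_double_point_def)

section \<open>Classification of the singular points\<close>

lemma sum_fibres:
  fixes h :: "'b \<Rightarrow> 'c::semiring_1"
  assumes "finite A"
  shows "(\<Sum>i\<in>A. h (u i)) = (\<Sum>z\<in>u ` A. of_nat (card {i \<in> A. u i = z}) * h z)"
  by (subst sum.image_gen[OF assms, of _ u]) (auto intro!: sum.cong)

definition fibre :: "coords \<Rightarrow> complex \<Rightarrow> 5 set" where
  "fibre v z = {i. v $ Some i = z}"

lemma psum_fibres:
  "psum r v = (\<Sum>z\<in>range (\<lambda>i. v $ Some i). of_nat (card (fibre v z)) * z ^ r)"
  using sum_fibres[of UNIV "\<lambda>z. z ^ r" "\<lambda>i. v $ Some i"] by (simp add: psum_def fibre_def)

lemma card_fibres: "(\<Sum>z\<in>range (\<lambda>i. v $ Some i). card (fibre v z)) = 5"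
  using sum_fibres[of UNIV "\<lambda>z. 1::nat" "\<lambda>i. v $ Some i"] by (simp add: fibre_def)

lemma card_fibre_pos: "card (fibre v z) > 0 \<longleftrightarrow> z \<in> range (\<lambda>i. v $ Some i)"
  by (auto simp: card_gt_0_iff fibre_def)

lemma hyperplane_iff_psum: "v \<in> hyperplane \<eta> \<longleftrightarrow> psum 1 v = \<eta> * v $ None"
  by (simp add: hyperplane_def psum_def)

text \<open>A denominator-free form for the method \<open>algebra\<close>, with
  \<open>\<eta> * v $ None\<close> kept as one unit, later called \<open>h\<close>.\<close>

lemma node_cubic_times_6:
  "6 * node_cubic \<eta> v z = 6 * z ^ 3 - 6 * (\<eta> * v $ None) * z ^ 2
    - 3 * (v $ None ^ 2 + psum 2 v) * z - 2 * psum 3 v + \<eta> * v $ None * (psum 2 v - v $ None ^ 2)"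
  by (simp add: node_cubic_def field_simps power2_eq_square power3_eq_cube)

text \<open>The divided difference of the cubic at two roots. The constant term cancels, and with it
  \<open>psum 3 v\<close>.\<close>

lemma node_cubic_diff:
  assumes "node_cubic \<eta> v \<alpha> = 0" "node_cubic \<eta> v \<beta> = 0" "\<alpha> \<noteq> \<beta>"
  shows "\<alpha> ^ 2 + \<alpha> * \<beta> + \<beta> ^ 2 - \<eta> * v $ None * (\<alpha> + \<beta>) - (v $ None ^ 2 + psum 2 v) / 2 = 0"
proof -
  have "(\<alpha> - \<beta>) * (\<alpha> ^ 2 + \<alpha> * \<beta> + \<beta> ^ 2 - \<eta> * v $ None * (\<alpha> + \<beta>) - (v $ None ^ 2 + psum 2 v) / 2)
      = node_cubic \<eta> v \<alpha> - node_cubic \<eta> v \<beta>"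
    by (simp add: node_cubic_def field_simps power2_eq_square power3_eq_cube)
  then show ?thesis using assms by simp
qed

text \<open>Vieta's formula for the quadratic coefficient: two divided differences sharing the root
  \<open>\<alpha>\<close> are subtracted and \<open>\<beta> - \<gamma>\<close> is cancelled.\<close>

lemma node_cubic_roots_sum:
  assumes "node_cubic \<eta> v \<alpha> = 0" "node_cubic \<eta> v \<beta> = 0" "node_cubic \<eta> v \<gamma> = 0"
    and "\<alpha> \<noteq> \<beta>" "\<alpha> \<noteq> \<gamma>" "\<beta> \<noteq> \<gamma>"
  shows "\<alpha> + \<beta> + \<gamma> = \<eta> * v $ None"
proof -
  have "(\<beta> - \<gamma>) * (\<alpha> + \<beta> + \<gamma> - \<eta> * v $ None) = 0"
    using node_cubic_diff[OF assms(1,2,4)] node_cubic_diff[OF assms(1,3,5)] by algebra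
  then show ?thesis using assms(6) by simp
qed

text \<open>With four distinct roots, two triples sharing two roots would have the same sum, so the
  remaining two roots would coincide.\<close>

lemma card_node_cubic_roots:
  assumes "finite Z" "\<And>z. z \<in> Z \<Longrightarrow> node_cubic \<eta> v z = 0"
  shows "card Z \<le> 3"
proof (rule ccontr)
  assume "\<not> card Z \<le> 3"
  then obtain Y where Y: "Y \<subseteq> Z" "card Y = 4"
    by (metis not_less_eq_eq numeral_3_eq_3 numeral_eq_Suc obtain_subset_with_card_n pred_numeral_simps(2) semiring_norm(26,27))
  then obtain \<alpha> \<beta> \<gamma> \<delta> where "Y = {\<alpha>, \<beta>, \<gamma>, \<delta>}" and d: "distinct [\<alpha>, \<beta>, \<gamma>, \<delta>]"
    by (auto simp: numeral_eq_Suc card_Suc_eq)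
  then have r: "node_cubic \<eta> v \<alpha> = 0" "node_cubic \<eta> v \<beta> = 0" "node_cubic \<eta> v \<gamma> = 0"
    "node_cubic \<eta> v \<delta> = 0"
    using Y assms(2) by auto
  have "\<alpha> + \<beta> + \<gamma> = \<alpha> + \<beta> + \<delta>"
    using node_cubic_roots_sum[OF r(1,2,3)] node_cubic_roots_sum[OF r(1,2,4)] d by simp
  then show False using d by simp
qed

lemma hcoords_nth [simp]: "hcoords a u $ None = a" "hcoords a u $ Some i = u i"
  by (simp_all add: hcoords_def)

lemma coords_eq_iff: "(v::coords) = w \<longleftrightarrow> v $ None = w $ None \<and> (\<forall>i. v $ Some i = w $ Some i)"
  by (simp add: vec_eq_iff split_option_all)

lemma proj_point_scale:
  assumes "t \<noteq> 0"
  shows "proj_point (t *s v) = proj_point v"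
proof -
  have "t *s v \<in> vec.span {v}"
    by (intro vec.span_scale vec.span_base) simp
  moreover have "inverse t *s (t *s v) \<in> vec.span {t *s v}"
    by (intro vec.span_scale vec.span_base) simp
  then have "v \<in> vec.span {t *s v}"
    using assms by (simp add: vector_smult_assoc)
  ultimately show ?thesis
    unfolding proj_point_def vec.span_eq by simp
qed

lemma proj_point_eqI: "t \<noteq> 0 \<Longrightarrow> v = t *s w \<Longrightarrow> proj_point v = proj_point w"
  by (simp add: proj_point_scale)

section \<open>Solving for the coordinates, one multiplicity pattern at a time\<close>

context
  fixes \<eta> :: complex and v :: coords
  assumes eta: "\<eta> ^ 2 = -3" and hyp: "v \<in> hyperplane \<eta>"
    and cubic: "\<And>i. node_cubic \<eta> v (v $ Some i) = 0"
begin

lemma root: "z \<in> range (\<lambda>i. v $ Some i) \<Longrightarrow> node_cubic \<eta> v z = 0"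
  using cubic by auto

lemma three_values:
  assumes "range (\<lambda>i. v $ Some i) = {\<alpha>, \<beta>, \<gamma>}" "\<alpha> \<noteq> \<beta>" "\<alpha> \<noteq> \<gamma>" "\<beta> \<noteq> \<gamma>"
  shows "\<alpha> + \<beta> + \<gamma> = \<eta> * v $ None"
    "\<alpha> ^ 2 + \<alpha> * \<beta> + \<beta> ^ 2 - \<eta> * v $ None * (\<alpha> + \<beta>) - (v $ None ^ 2 + psum 2 v) / 2 = 0"
    "psum r v = of_nat (card (fibre v \<alpha>)) * \<alpha> ^ r + of_nat (card (fibre v \<beta>)) * \<beta> ^ r +
       of_nat (card (fibre v \<gamma>)) * \<gamma> ^ r"
    "card (fibre v \<alpha>) + card (fibre v \<beta>) + card (fibre v \<gamma>) = 5"
proof -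
  have roots: "node_cubic \<eta> v \<alpha> = 0" "node_cubic \<eta> v \<beta> = 0" "node_cubic \<eta> v \<gamma> = 0"
    by (rule root, simp add: assms(1))+
  show "\<alpha> + \<beta> + \<gamma> = \<eta> * v $ None"
    using roots assms(2-4) by (rule node_cubic_roots_sum)
  show "\<alpha> ^ 2 + \<alpha> * \<beta> + \<beta> ^ 2 - \<eta> * v $ None * (\<alpha> + \<beta>) - (v $ None ^ 2 + psum 2 v) / 2 = 0"
    using roots(1,2) assms(2) by (rule node_cubic_diff)
  show "psum r v = of_nat (card (fibre v \<alpha>)) * \<alpha> ^ r + of_nat (card (fibre v \<beta>)) * \<beta> ^ r +
       of_nat (card (fibre v \<gamma>)) * \<gamma> ^ r"
    unfolding psum_fibres assms(1) using assms(2-4) by (simp add: add_ac)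
  show "card (fibre v \<alpha>) + card (fibre v \<beta>) + card (fibre v \<gamma>) = 5"
    using card_fibres[of v] unfolding assms(1) using assms(2-4) by simp
qed

text \<open>The weighted sum minus the plain sum of the values is \<open>\<alpha> + \<beta>\<close>,
  hence zero. The divided difference then reduces to
  \<open>\<alpha> ^ 2 = v $ None ^ 2\<close>.\<close>

lemma fibres_221:
  assumes r: "range (\<lambda>i. v $ Some i) = {\<alpha>, \<beta>, \<gamma>}" "\<alpha> \<noteq> \<beta>" "\<alpha> \<noteq> \<gamma>" "\<beta> \<noteq> \<gamma>"
    and c: "card (fibre v \<alpha>) = 2" "card (fibre v \<beta>) = 2" "card (fibre v \<gamma>) = 1"
  shows "\<gamma> = \<eta> * v $ None \<and> \<beta> = - \<alpha> \<and> \<alpha> ^ 2 = v $ None ^ 2"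
proof -
  note t = three_values[OF r]
  have "2 * \<alpha> + 2 * \<beta> + \<gamma> = \<eta> * v $ None"
    using t(3)[of 1] hyp by (simp add: c hyperplane_iff_psum)
  then have g: "\<gamma> = \<eta> * v $ None" and b: "\<beta> = - \<alpha>"
    using t(1) by algebra+
  have "psum 2 v = 2 * \<alpha> ^ 2 + 2 * \<beta> ^ 2 + \<gamma> ^ 2"
    using t(3)[of 2] by (simp add: c)
  then have "psum 2 v = 4 * \<alpha> ^ 2 - 3 * v $ None ^ 2"
    using g b eta by (simp add: power_mult_distrib)
  then have "\<alpha> ^ 2 = v $ None ^ 2"
    using t(2) b by (simp add: power2_eq_square)
  then show ?thesis using g b by simp
qed

text \<open>The weighted sum minus the plain sum is \<open>2 * \<alpha>\<close>, so
  \<open>\<alpha>\<close> vanishes. The divided difference then collapses to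
  \<open>v $ None ^ 2 = 0\<close>.\<close>

lemma fibres_311:
  assumes r: "range (\<lambda>i. v $ Some i) = {\<alpha>, \<beta>, \<gamma>}" "\<alpha> \<noteq> \<beta>" "\<alpha> \<noteq> \<gamma>" "\<beta> \<noteq> \<gamma>"
    and c: "card (fibre v \<alpha>) = 3" "card (fibre v \<beta>) = 1" "card (fibre v \<gamma>) = 1"
  shows "v $ None = 0 \<and> \<alpha> = 0 \<and> \<gamma> = - \<beta>"
proof -
  note t = three_values[OF r]
  have "3 * \<alpha> + \<beta> + \<gamma> = \<eta> * v $ None"
    using t(3)[of 1] hyp by (simp add: c hyperplane_iff_psum)
  then have a: "\<alpha> = 0" and g: "\<gamma> = \<eta> * v $ None - \<beta>"
    using t(1) by algebra+
  have "psum 2 v = 3 * \<alpha> ^ 2 + \<beta> ^ 2 + \<gamma> ^ 2"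
    using t(3)[of 2] by (simp add: c)
  then have "psum 2 v = \<beta> ^ 2 + (\<eta> * v $ None - \<beta>) ^ 2"
    using a g by simp
  then have "v $ None ^ 2 = 0"
    using t(2) a eta by algebra
  then show ?thesis using a g by simp
qed

lemma two_values:
  assumes "range (\<lambda>i. v $ Some i) = {\<alpha>, \<beta>}" "\<alpha> \<noteq> \<beta>"
  shows "\<alpha> ^ 2 + \<alpha> * \<beta> + \<beta> ^ 2 - \<eta> * v $ None * (\<alpha> + \<beta>) - (v $ None ^ 2 + psum 2 v) / 2 = 0"
    "psum r v = of_nat (card (fibre v \<alpha>)) * \<alpha> ^ r + of_nat (card (fibre v \<beta>)) * \<beta> ^ r"
    "card (fibre v \<alpha>) + card (fibre v \<beta>) = 5"
proof -
  have roots: "node_cubic \<eta> v \<alpha> = 0" "node_cubic \<eta> v \<beta> = 0"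
    by (rule root, simp add: assms(1))+
  show "\<alpha> ^ 2 + \<alpha> * \<beta> + \<beta> ^ 2 - \<eta> * v $ None * (\<alpha> + \<beta>) - (v $ None ^ 2 + psum 2 v) / 2 = 0"
    using roots assms(2) by (rule node_cubic_diff)
  show "psum r v = of_nat (card (fibre v \<alpha>)) * \<alpha> ^ r + of_nat (card (fibre v \<beta>)) * \<beta> ^ r"
    unfolding psum_fibres assms(1) using assms(2) by simp
  show "card (fibre v \<alpha>) + card (fibre v \<beta>) = 5"
    using card_fibres[of v] unfolding assms(1) using assms(2) by simp
qed

lemma fibres_41:
  assumes r: "range (\<lambda>i. v $ Some i) = {\<alpha>, \<beta>}" "\<alpha> \<noteq> \<beta>"
    and c: "card (fibre v \<alpha>) = 4" "card (fibre v \<beta>) = 1"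
  shows "v $ None \<noteq> 0 \<and> \<alpha> = \<eta> / 3 * v $ None \<and> \<beta> = - \<eta> / 3 * v $ None"
proof -
  note t = two_values[OF r]
  define h where "h = \<eta> * v $ None"
  have h2: "h ^ 2 = -3 * v $ None ^ 2" using eta by (simp add: h_def power_mult_distrib)
  have p: "psum 2 v = 4 * \<alpha> ^ 2 + \<beta> ^ 2" "psum 3 v = 4 * \<alpha> ^ 3 + \<beta> ^ 3"
    using t(2) by (simp_all add: c)
  have b: "\<beta> = h - 4 * \<alpha>"
    using t(2)[of 1] hyp by (simp add: c hyperplane_iff_psum h_def algebra_simps)
  \<comment> \<open>The divided difference determines \<open>\<alpha>\<close> only up to sign; the
    wrong sign is removed by the cubic itself.\<close>
  have "(3 * \<alpha> - h) * (3 * \<alpha> + h) = 0"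
    using t(1) unfolding p h_def[symmetric] b using h2 by algebra
  then consider "3 * \<alpha> = h" | "3 * \<alpha> = - h"
    by (auto simp: add_eq_0_iff)
  then have "3 * \<alpha> = h"
  proof cases
    \<comment> \<open>Here the cubic becomes a nonzero multiple of \<open>\<alpha> ^ 3\<close>, so
      \<open>\<alpha>\<close> and \<open>h\<close> both vanish and the goal holds trivially. This
      degenerate solution is excluded afterwards by
      \<open>\<alpha> \<noteq> \<beta>\<close>.\<close>
    case 2
    then have h: "h = - 3 * \<alpha>" and b: "\<beta> = - 7 * \<alpha>"
      using b by (simp_all add: minus_equation_iff[of _ h])
    have "node_cubic \<eta> v \<alpha> = 0" using r(1) root by auto
    then have "6 * \<alpha> ^ 3 - 6 * h * \<alpha> ^ 2 - 3 * (v $ None ^ 2 + psum 2 v) * \<alpha> - 2 * psum 3 v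
        + h * (psum 2 v - v $ None ^ 2) = 0"
      using node_cubic_times_6[of \<eta> v \<alpha>] by (simp add: h_def)
    then have "\<alpha> ^ 3 = 0"
      unfolding p using h h2 b by algebra
    then show ?thesis using h by simp
  qed simp
  then have \<alpha>: "\<alpha> = h / 3" by (simp add: field_simps)
  then have \<beta>: "\<beta> = - h / 3" using b unfolding \<alpha> by simp
  have "h \<noteq> 0" using r(2) \<alpha> \<beta> by auto
  then show ?thesis
    using \<alpha> \<beta> by (simp add: h_def)
qed

lemma fibres_32:
  assumes r: "range (\<lambda>i. v $ Some i) = {\<alpha>, \<beta>}" "\<alpha> \<noteq> \<beta>"
    and c: "card (fibre v \<alpha>) = 3" "card (fibre v \<beta>) = 2"
  shows False
proof -
  note t = two_values[OF r]
  define h where "h = \<eta> * v $ None"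
  have h2: "h ^ 2 = -3 * v $ None ^ 2" using eta by (simp add: h_def power_mult_distrib)
  have p: "psum 2 v = 3 * \<alpha> ^ 2 + 2 * \<beta> ^ 2" "psum 3 v = 3 * \<alpha> ^ 3 + 2 * \<beta> ^ 3"
    using t(2) by (simp_all add: c)
  have b: "2 * \<beta> = h - 3 * \<alpha>"
    using t(2)[of 1] hyp by (simp add: c hyperplane_iff_psum h_def algebra_simps)
  have a2: "2 * \<alpha> ^ 2 = h * \<alpha> + v $ None ^ 2"
    using t(1) unfolding p h_def[symmetric] using h2 b by algebra
  have "node_cubic \<eta> v \<alpha> = 0" using r(1) root by auto
  then have "6 * \<alpha> ^ 3 - 6 * h * \<alpha> ^ 2 - 3 * (v $ None ^ 2 + psum 2 v) * \<alpha> - 2 * psum 3 v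
      + h * (psum 2 v - v $ None ^ 2) = 0"
    using node_cubic_times_6[of \<eta> v \<alpha>] by (simp add: h_def)
  \<comment> \<open>The remainder of the cubic modulo the quadratic relation \<open>a2\<close>,
    after \<open>h ^ 2\<close> is replaced by \<open>-3 * v $ None ^ 2\<close>; this is where 15 and
    19 come from.\<close>
  then have "v $ None ^ 2 * (15 * \<alpha> - 19 * h) = 0"
    unfolding p using h2 a2 b by algebra
  moreover have "v $ None = 0" if "15 * \<alpha> = 19 * h"
  proof -
    have "v $ None ^ 2 = 0" using a2 h2 that by algebra
    then show ?thesis by simp
  qed
  ultimately have "v $ None = 0" by auto
  then have "\<alpha> = 0" "\<beta> = 0" using a2 b h2 by auto
  then show False using r(2) by simp
qed

lemma fibres_5:
  assumes r: "range (\<lambda>i. v $ Some i) = {\<alpha>}"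
  shows "v = 0"
proof -
  define h where "h = \<eta> * v $ None"
  have u: "v $ Some i = \<alpha>" for i using r by auto
  have p: "psum r v = 5 * \<alpha> ^ r" for r by (simp add: psum_def u)
  have h: "h = 5 * \<alpha>" and h2: "h ^ 2 = -3 * v $ None ^ 2"
    using hyp eta by (simp_all add: hyperplane_iff_psum p h_def power_mult_distrib)
  have "node_cubic \<eta> v \<alpha> = 0" using r root by auto
  then have "6 * \<alpha> ^ 3 - 6 * h * \<alpha> ^ 2 - 3 * (v $ None ^ 2 + psum 2 v) * \<alpha> - 2 * psum 3 v
      + h * (psum 2 v - v $ None ^ 2) = 0"
    using node_cubic_times_6[of \<eta> v \<alpha>] by (simp add: h_def)
  then have "\<alpha> ^ 3 = 0"
    unfolding p using h h2 by algebra
  then have "\<alpha> = 0" by simp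
  then show ?thesis using h h2 u by (simp add: coords_eq_iff)
qed

lemma R_point_eq:
  assumes "v $ None \<noteq> 0" "range (\<lambda>i. v $ Some i) = {v $ None, - v $ None, \<eta> * v $ None}"
    and c: "card (fibre v (v $ None)) = 2" "card (fibre v (- v $ None)) = 2"
      "card (fibre v (\<eta> * v $ None)) = 1"
  shows "proj_point v \<in> R_nodes \<eta>"
proof -
  let ?A = "fibre v (- v $ None)" and ?B = "fibre v (v $ None)"
  have "\<eta> \<noteq> 1" "\<eta> \<noteq> -1" using eta by auto
  obtain c where c': "fibre v (\<eta> * v $ None) = {c}"
    using c(3) card_1_singletonE by blast
  have range: "v $ Some i \<in> {v $ None, - v $ None, \<eta> * v $ None}" for i
    using assms(2) by blast
  then have U: "?A \<union> ?B \<union> {c} = UNIV"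
    unfolding c'[symmetric] by (auto simp: fibre_def)
  have "v $ Some i = v $ None * (if i \<in> ?A then -1 else if i \<in> ?B then 1 else \<eta>)" for i
    using range[of i] by (auto simp: fibre_def mult.commute)
  then have "v = v $ None *s hcoords 1 (\<lambda>i. if i \<in> ?A then -1 else if i \<in> ?B then 1 else \<eta>)"
    by (simp add: coords_eq_iff del: if_split)
  then have "proj_point v = R_point \<eta> ?A ?B"
    unfolding R_point_def by (rule proj_point_eqI[OF assms(1)])
  moreover have "?A \<inter> ?B = {}" using assms(1) by (auto simp: fibre_def)
  moreover have "v $ Some c = \<eta> * v $ None" using c' by (auto simp: fibre_def)
  then have "v $ Some c \<noteq> v $ None" "v $ Some c \<noteq> - v $ None"
    using assms(1) \<open>\<eta> \<noteq> 1\<close> \<open>\<eta> \<noteq> -1\<close> mult_cancel_right[of \<eta> "v $ None" "-1"] by auto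
  then have "c \<notin> ?A \<union> ?B" by (simp add: fibre_def)
  ultimately show ?thesis
    unfolding R_nodes_def using U c by blast
qed

text \<open>The relation \<open>\<alpha> ^ 2 = v $ None ^ 2\<close> leaves a sign, which only
  decides which of the two double fibres is \<open>A\<close> and which is \<open>B\<close>.\<close>

lemma R_node_221:
  assumes r: "range (\<lambda>i. v $ Some i) = {\<alpha>, \<beta>, \<gamma>}" "\<alpha> \<noteq> \<beta>" "\<alpha> \<noteq> \<gamma>" "\<beta> \<noteq> \<gamma>"
    and c: "card (fibre v \<alpha>) = 2" "card (fibre v \<beta>) = 2" "card (fibre v \<gamma>) = 1"
  shows "proj_point v \<in> R_nodes \<eta>"
proof -
  have f: "\<gamma> = \<eta> * v $ None" "\<beta> = - \<alpha>" "\<alpha> ^ 2 = v $ None ^ 2"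
    using fibres_221[OF r c] by auto
  then have a: "v $ None \<noteq> 0" using r(2) by auto
  from f(3) consider "\<alpha> = v $ None" | "\<alpha> = - v $ None" by (auto simp: power2_eq_iff)
  then show ?thesis
  proof cases
    case 1
    show ?thesis
      by (rule R_point_eq[OF a]) (use 1 r(1) c f(1,2) in simp_all)
  next
    case 2
    have "range (\<lambda>i. v $ Some i) = {\<beta>, \<alpha>, \<gamma>}" using r(1) by auto
    then show ?thesis
      by (intro R_point_eq[OF a]) (use 2 c f(1,2) in simp_all)
  qed
qed

lemma T_node_311:
  assumes r: "range (\<lambda>i. v $ Some i) = {\<alpha>, \<beta>, \<gamma>}" "\<alpha> \<noteq> \<beta>" "\<alpha> \<noteq> \<gamma>" "\<beta> \<noteq> \<gamma>"
    and c: "card (fibre v \<alpha>) = 3" "card (fibre v \<beta>) = 1" "card (fibre v \<gamma>) = 1"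
  shows "proj_point v \<in> T_nodes"
proof -
  have f: "v $ None = 0" "\<alpha> = 0" "\<gamma> = - \<beta>" using fibres_311[OF r c] by auto
  obtain p q where pq: "fibre v \<beta> = {p}" "fibre v \<gamma> = {q}"
    using c(2,3) card_1_singletonE by metis
  then have "p \<noteq> q" "v $ Some p = \<beta>" "v $ Some q = \<gamma>" using r(4) by (auto simp: fibre_def)
  have "v $ Some i = 0" if "i \<noteq> p" "i \<noteq> q" for i
    using that r(1) pq f(2) unfolding fibre_def by auto
  then have "v = \<beta> *s hcoords 0 (\<lambda>i. if i = p then 1 else if i = q then -1 else 0)"
    using \<open>v $ Some p = \<beta>\<close> \<open>v $ Some q = \<gamma>\<close> f by (auto simp: coords_eq_iff)
  then have "proj_point v = T_point p q"
    unfolding T_point_def using r(2) f(2) by (intro proj_point_eqI) auto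
  then show ?thesis using \<open>p \<noteq> q\<close> by (auto simp: T_nodes_def)
qed

lemma E_node_41:
  assumes r: "range (\<lambda>i. v $ Some i) = {\<alpha>, \<beta>}" "\<alpha> \<noteq> \<beta>"
    and c: "card (fibre v \<alpha>) = 4" "card (fibre v \<beta>) = 1"
  shows "proj_point v \<in> E_nodes \<eta>"
proof -
  have f: "v $ None \<noteq> 0" "\<alpha> = \<eta> / 3 * v $ None" "\<beta> = - \<eta> / 3 * v $ None"
    using fibres_41[OF r c] by auto
  obtain c where c: "fibre v \<beta> = {c}"
    using c(2) card_1_singletonE by metis
  then have "v $ Some c = \<beta>" by (auto simp: fibre_def)
  have "v $ Some i = \<alpha>" if "i \<noteq> c" for i
    using that r(1) c unfolding fibre_def by auto
  then have "v = v $ None *s hcoords 1 (\<lambda>i. if i = c then - \<eta> / 3 else \<eta> / 3)"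
    using \<open>v $ Some c = \<beta>\<close> f by (auto simp: coords_eq_iff)
  then have "proj_point v = E_point \<eta> c"
    unfolding E_point_def by (rule proj_point_eqI[OF f(1)])
  then show ?thesis by (simp add: E_nodes_def)
qed

lemma node_cubic_classification:
  assumes "v \<noteq> 0"
  shows "proj_point v \<in> R_nodes \<eta> \<union> T_nodes \<union> E_nodes \<eta>"
proof -
  let ?Z = "range (\<lambda>i. v $ Some i)"
  have "card ?Z \<le> 3"
    by (rule card_node_cubic_roots[of _ \<eta> v]) (simp, rule root)
  moreover have "card ?Z \<noteq> 0" by simp
  ultimately consider "card ?Z = 1" | "card ?Z = 2" | "card ?Z = 3" by linarith
  then show ?thesis
  proof cases
    case 1
    then obtain \<alpha> where "?Z = {\<alpha>}" by (rule card_1_singletonE)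
    then show ?thesis using fibres_5 assms by blast
  next
    case 2
    then obtain \<alpha> \<beta> where r: "?Z = {\<alpha>, \<beta>}" "\<alpha> \<noteq> \<beta>" by (auto simp: card_2_iff)
    then have r': "?Z = {\<beta>, \<alpha>}" "\<beta> \<noteq> \<alpha>" by auto
    have "card (fibre v \<alpha>) > 0" "card (fibre v \<beta>) > 0" using r by (simp_all add: card_fibre_pos)
    then consider "card (fibre v \<alpha>) = 4" "card (fibre v \<beta>) = 1"
      | "card (fibre v \<alpha>) = 1" "card (fibre v \<beta>) = 4"
      | "card (fibre v \<alpha>) = 3" "card (fibre v \<beta>) = 2"
      | "card (fibre v \<alpha>) = 2" "card (fibre v \<beta>) = 3"
      using two_values(3)[OF r] by linarith
    then have "proj_point v \<in> E_nodes \<eta>"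
    proof cases
      case 1 then show ?thesis by (rule E_node_41[OF r])
    next
      case 2 then show ?thesis using E_node_41[OF r'] by simp
    next
      case 3 with fibres_32[OF r] show ?thesis by simp
    next
      case 4 with fibres_32[OF r'] show ?thesis by simp
    qed
    then show ?thesis by simp
  next
    case 3
    then obtain \<alpha> \<beta> \<gamma> where r: "?Z = {\<alpha>, \<beta>, \<gamma>}" "\<alpha> \<noteq> \<beta>" "\<alpha> \<noteq> \<gamma>" "\<beta> \<noteq> \<gamma>"
      by (auto simp: card_3_iff)
    \<comment> \<open>Cyclic rotations suffice: both patterns single out one value, the first in
      3+1+1 and the last in 2+2+1, and each has a conclusion valid for either order of the other
      two.\<close>
    then have r2: "?Z = {\<beta>, \<gamma>, \<alpha>}" "\<beta> \<noteq> \<gamma>" "\<beta> \<noteq> \<alpha>" "\<gamma> \<noteq> \<alpha>"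
      and r3: "?Z = {\<gamma>, \<alpha>, \<beta>}" "\<gamma> \<noteq> \<alpha>" "\<gamma> \<noteq> \<beta>" "\<alpha> \<noteq> \<beta>" by auto
    let ?c = "\<lambda>z. card (fibre v z)"
    have pos: "?c \<alpha> > 0" "?c \<beta> > 0" "?c \<gamma> > 0" using r by (simp_all add: card_fibre_pos)
    have "?c \<alpha> = 1 \<or> ?c \<alpha> = 2 \<or> ?c \<alpha> = 3" "?c \<beta> = 1 \<or> ?c \<beta> = 2 \<or> ?c \<beta> = 3"
      using pos three_values(4)[OF r] by linarith+
    moreover have "?c \<gamma> = 5 - ?c \<alpha> - ?c \<beta>" using three_values(4)[OF r] by simp
    ultimately consider "?c \<alpha> = 3" "?c \<beta> = 1" "?c \<gamma> = 1" | "?c \<beta> = 3" "?c \<gamma> = 1" "?c \<alpha> = 1"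
      | "?c \<gamma> = 3" "?c \<alpha> = 1" "?c \<beta> = 1" | "?c \<alpha> = 2" "?c \<beta> = 2" "?c \<gamma> = 1"
      | "?c \<beta> = 2" "?c \<gamma> = 2" "?c \<alpha> = 1" | "?c \<gamma> = 2" "?c \<alpha> = 2" "?c \<beta> = 1"
      using pos(3) by (elim disjE) simp_all
    then have "proj_point v \<in> R_nodes \<eta> \<union> T_nodes"
    proof cases
      case 1 then show ?thesis using T_node_311[OF r] by simp
    next
      case 2 then show ?thesis using T_node_311[OF r2] by simp
    next
      case 3 then show ?thesis using T_node_311[OF r3] by simp
    next
      case 4 then show ?thesis using R_node_221[OF r] by simp
    next
      case 5 then show ?thesis using R_node_221[OF r2] by simp
    next
      case 6 then show ?thesis using R_node_221[OF r3] by simp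
    qed
    then show ?thesis by blast
  qed
qed

end

section \<open>Nondegeneracy of the Hessian\<close>

text \<open>The Hessian regrouped as a linear form in \<open>y\<close>, so that a \<open>y\<close>
  with few nonzero coordinates reads off its coefficients.\<close>

lemma quartic_hess_linear:
  defines "s \<equiv> \<lambda>v x. \<Sum>i\<in>UNIV. v $ Some i * x $ Some i"
  shows "quartic_hess \<eta> v x y =
    ((psum 2 v - 3 * v $ None ^ 2) / 2 * x $ None + v $ None * s v x
      + \<eta> * (\<Sum>i\<in>UNIV. v $ Some i ^ 2 * x $ Some i)) * y $ None +
    (\<Sum>i\<in>UNIV. (v $ None * x $ None * v $ Some i + \<eta> * x $ None * v $ Some i ^ 2 + s v x * v $ Some i
      + ((v $ None ^ 2 + psum 2 v) / 2 + 2 * \<eta> * v $ None * v $ Some i - 3 * v $ Some i ^ 2) * x $ Some i)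
      * y $ Some i)"
proof -
  have *: "(\<Sum>i\<in>UNIV. (A * v $ Some i + B * v $ Some i ^ 2 + C * v $ Some i + h i * x $ Some i) * y $ Some i) =
      A * s v y + B * (\<Sum>i\<in>UNIV. v $ Some i ^ 2 * y $ Some i) + C * s v y +
      (\<Sum>i\<in>UNIV. h i * x $ Some i * y $ Some i)" for A B C h
    by (simp add: s_def sum.distrib sum_distrib_left algebra_simps)
  show ?thesis
    unfolding quartic_hess_def * by (simp add: s_def algebra_simps)
qed

lemma sum_two:
  fixes f :: "5 \<Rightarrow> complex"
  assumes "i \<noteq> j"
  shows "(\<Sum>k\<in>UNIV. f k * (if k = i then 1 else if k = j then -1 else 0)) = f i - f j"
proof -
  have "(\<Sum>k\<in>UNIV. f k * (if k = i then 1 else if k = j then -1 else 0)) =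
      (\<Sum>k\<in>UNIV. (if k = i then f k else 0) - (if k = j then f k else 0))"
    using assms by (intro sum.cong) auto
  then show ?thesis by (simp add: sum_subtractf)
qed

text \<open>Obtained by testing the Hessian against the difference of the unit vectors at \<open>i\<close> and \<open>j\<close>.\<close>

lemma hess_radical_None:
  assumes "v $ None = 1" "x $ None = 0"
    and "\<forall>y\<in>hyperplane \<eta>. y $ None = 0 \<longrightarrow> quartic_hess \<eta> v x y = 0"
  defines "s \<equiv> \<Sum>i\<in>UNIV. v $ Some i * x $ Some i"
    and "g \<equiv> \<lambda>u. (1 + psum 2 v) / 2 + 2 * \<eta> * u - 3 * u ^ 2"
  shows "s * v $ Some i + g (v $ Some i) * x $ Some i = s * v $ Some j + g (v $ Some j) * x $ Some j"
proof (cases "i = j")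
  case False
  let ?y = "hcoords 0 (\<lambda>k. if k = i then 1 else if k = j then -1 else 0)"
  have "?y \<in> hyperplane \<eta>"
    using sum_two[OF False, of "\<lambda>_. 1"] by (simp add: hyperplane_def)
  then have "quartic_hess \<eta> v x ?y = 0" using assms(3) by simp
  then show ?thesis
    unfolding quartic_hess_linear hcoords_nth sum_two[OF False] using assms(1,2)
    by (simp add: s_def g_def)
qed simp

text \<open>The test vector here has $a = 1$, $u_i = \eta$ and all other coordinates zero.\<close>

lemma hess_radical_Some:
  assumes "v $ None = 0" "x \<in> hyperplane \<eta>" "x $ Some p = 0" "psum 2 v = 2"
    and "\<forall>y\<in>hyperplane \<eta>. y $ Some p = 0 \<longrightarrow> quartic_hess \<eta> v x y = 0"
  defines "s \<equiv> \<Sum>i\<in>UNIV. v $ Some i * x $ Some i"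
  defines "g \<equiv> \<lambda>i. \<eta> * x $ None * v $ Some i ^ 2 + s * v $ Some i + (1 - 3 * v $ Some i ^ 2) * x $ Some i"
  assumes "i \<noteq> p"
  shows "x $ None + \<eta> * (\<Sum>i\<in>UNIV. v $ Some i ^ 2 * x $ Some i) + \<eta> * g i = 0"
proof -
  let ?y = "hcoords 1 (\<lambda>k. if k = i then \<eta> else 0)"
  have "?y \<in> hyperplane \<eta>"
    by (simp add: hyperplane_def)
  then have "quartic_hess \<eta> v x ?y = 0" using assms(5,8) by simp
  moreover have *: "(\<Sum>k\<in>UNIV. h k * (if k = i then \<eta> else 0)) = h i * \<eta>" for h
    by (simp add: if_distrib cong: if_cong)
  ultimately show ?thesis
    unfolding quartic_hess_linear hcoords_nth * using assms(1,4)
    by (simp add: s_def g_def algebra_simps)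
qed

text \<open>The chart \<open>k\<close> stays free: \<open>None\<close> serves the points with
  \<open>a = 1\<close>, while the points \<open>T_point p q\<close> have \<open>a = 0\<close> and
  need \<open>Some p\<close>.\<close>

lemma nodes_I:
  assumes "\<eta> ^ 2 = -3" "v \<in> hyperplane \<eta>" "\<And>i. node_cubic \<eta> v (v $ Some i) = 0" "v $ k \<noteq> 0"
    and "\<And>x. x \<in> hyperplane \<eta> \<Longrightarrow> x $ k = 0 \<Longrightarrow>
      \<forall>y\<in>hyperplane \<eta>. y $ k = 0 \<longrightarrow> quartic_hess \<eta> v x y = 0 \<Longrightarrow> x = 0"
  shows "proj_point v \<in> nodes \<eta>"
proof -
  have "ordinary_double_point quartic (hyperplane \<eta>) v"
    unfolding ordinary_double_point_quartic[OF assms(1)] using assms by blast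
  moreover have "v \<noteq> 0" using assms(4) by auto
  ultimately show ?thesis unfolding nodes_def proj_locus_def by blast
qed

lemma R_point_node:
  assumes eta: "\<eta> ^ 2 = -3" and AB: "card A = 2" "card B = 2" "A \<inter> B = {}"
    "c \<notin> A \<union> B" "A \<union> B \<union> {c} = UNIV"
  shows "R_point \<eta> A B \<in> nodes \<eta>"
proof -
  define v where "v = hcoords 1 (\<lambda>i. if i \<in> A then -1 else if i \<in> B then 1 else \<eta>)"
  have v0: "v $ None = 1" and vA: "i \<in> A \<Longrightarrow> v $ Some i = -1" and vB: "i \<in> B \<Longrightarrow> v $ Some i = 1"
    and vc: "v $ Some c = \<eta>" for i
    using AB by (auto simp: v_def)
  have sum: "(\<Sum>i\<in>UNIV. f i) = (\<Sum>i\<in>A. f i) + (\<Sum>i\<in>B. f i) + f c" for f :: "5 \<Rightarrow> complex"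
    using AB(3,4) by (simp add: AB(5)[symmetric] sum.union_disjoint add_ac)
  have cases: "i \<in> A \<or> i \<in> B \<or> i = c" for i using AB(5) by blast
  have p: "psum r v = 2 * (-1) ^ r + 2 + \<eta> ^ r" for r
    by (simp add: psum_def sum vA vB vc AB)
  have hyp: "v \<in> hyperplane \<eta>" by (simp add: hyperplane_iff_psum p v0)
  have eta3: "\<eta> ^ 3 = -3 * \<eta>" using eta by (simp add: power3_eq_cube power2_eq_square)
  have cubic: "node_cubic \<eta> v (v $ Some i) = 0" for i
    using cases[of i] by (auto simp: node_cubic_def p v0 vA vB vc eta eta3)
  have "x = 0" if x: "x \<in> hyperplane \<eta>" "x $ None = 0"
    and rad: "\<forall>y\<in>hyperplane \<eta>. y $ None = 0 \<longrightarrow> quartic_hess \<eta> v x y = 0" for x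
  proof -
    define s where "s = (\<Sum>i\<in>UNIV. v $ Some i * x $ Some i)"
    \<comment> \<open>The value at \<open>c\<close> of the quantity that the radical condition makes
      independent of the index; the diagonal coefficient there is
      \<open>1 - \<eta> ^ 2 = 4\<close>.\<close>
    define \<mu> where "\<mu> = s * \<eta> + 4 * x $ Some c"
    have rad: "s * v $ Some i + (1 + 2 * \<eta> * v $ Some i - 3 * v $ Some i ^ 2) * x $ Some i = \<mu>" for i
      using hess_radical_None[OF v0 x(2) rad, of i c, folded s_def]
      by (simp add: p eta vc \<mu>_def algebra_simps eta_mult[OF eta])
    \<comment> \<open>The diagonal coefficient is \<open>- 2 * \<eta> - 2\<close> on
      \<open>A\<close> and \<open>2 * \<eta> - 2\<close> on \<open>B\<close>. These are complex
      conjugates with product 16, so each is inverted by multiplying with the other.\<close>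
    define xA where "xA = (\<mu> + s) * (2 * \<eta> - 2) / 16"
    define xB where "xB = (\<mu> - s) * (- 2 * \<eta> - 2) / 16"
    have A: "x $ Some i = xA" if "i \<in> A" for i
    proof -
      have *: "\<mu> + s = (- 2 * \<eta> - 2) * x $ Some i"
        unfolding rad[of i, symmetric] vA[OF that] by (simp add: algebra_simps)
      have "(\<mu> + s) * (2 * \<eta> - 2) = 16 * x $ Some i"
        unfolding * by (simp add: algebra_simps eta_mult[OF eta])
      then show ?thesis by (simp add: xA_def)
    qed
    have B: "x $ Some i = xB" if "i \<in> B" for i
    proof -
      have *: "\<mu> - s = (2 * \<eta> - 2) * x $ Some i"
        unfolding rad[of i, symmetric] vB[OF that] by (simp add: algebra_simps)
      have "(\<mu> - s) * (- 2 * \<eta> - 2) = 16 * x $ Some i"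
        unfolding * by (simp add: algebra_simps eta_mult[OF eta])
      then show ?thesis by (simp add: xB_def)
    qed
    have "2 * xA + 2 * xB + x $ Some c = 0"
      using x AB by (simp add: hyperplane_def sum A B)
    moreover have "s = - 2 * xA + 2 * xB + \<eta> * x $ Some c"
      unfolding s_def using AB by (simp add: sum A B vA vB vc)
    moreover have "16 * xA = (\<mu> + s) * (2 * \<eta> - 2)" "16 * xB = (\<mu> - s) * (- 2 * \<eta> - 2)"
      by (simp_all add: xA_def xB_def)
    ultimately have s: "s = 0" and \<mu>: "\<mu> = 0"
      using \<mu>_def eta by algebra+
    then have "x $ Some c = 0" "xA = 0" "xB = 0" using \<mu>_def by (simp_all add: xA_def xB_def)
    then have "x $ Some i = 0" for i using cases[of i] A B by auto
    then show ?thesis using x(2) by (simp add: coords_eq_iff)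
  qed
  then show ?thesis
    using nodes_I[OF eta hyp cubic, of None] v0 by (simp add: R_point_def v_def)
qed

lemma E_point_node:
  assumes eta: "\<eta> ^ 2 = -3"
  shows "E_point \<eta> c \<in> nodes \<eta>"
proof -
  define v where "v = hcoords 1 (\<lambda>i. if i = c then - \<eta> / 3 else \<eta> / 3)"
  have v0: "v $ None = 1" and vi: "i \<noteq> c \<Longrightarrow> v $ Some i = \<eta> / 3" and vc: "v $ Some c = - \<eta> / 3" for i
    by (auto simp: v_def)
  have sum: "(\<Sum>i\<in>UNIV. f i) = f c + (\<Sum>i\<in>UNIV - {c}. f i)" for f :: "5 \<Rightarrow> complex"
    by (simp add: sum.remove)
  have p: "psum r v = (- \<eta> / 3) ^ r + 4 * (\<eta> / 3) ^ r" for r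
    by (simp add: psum_def sum vi vc)
  have hyp: "v \<in> hyperplane \<eta>" by (simp add: hyperplane_iff_psum p v0)
  have eta3: "\<eta> ^ 3 = -3 * \<eta>" using eta by (simp add: power3_eq_cube power2_eq_square)
  have cubic: "node_cubic \<eta> v (v $ Some i) = 0" for i
    by (cases "i = c") (auto simp: node_cubic_def p v0 vi vc eta eta3 power_divide)
  have "x = 0" if x: "x \<in> hyperplane \<eta>" "x $ None = 0"
    and rad: "\<forall>y\<in>hyperplane \<eta>. y $ None = 0 \<longrightarrow> quartic_hess \<eta> v x y = 0" for x
  proof -
    define s where "s = (\<Sum>i\<in>UNIV. v $ Some i * x $ Some i)"
    \<comment> \<open>The diagonal coefficient of the Hessian is \<open>8 / 3\<close> at
      \<open>c\<close> and \<open>- 4 / 3\<close> at the other indices, which also explains the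
      factor \<open>3 / 4\<close> in \<open>z\<close> below.\<close>
    define \<mu> where "\<mu> = - s * \<eta> / 3 + 8 / 3 * x $ Some c"
    have rad: "s * v $ Some i + (- (1 / 3) + 2 * \<eta> * v $ Some i - 3 * v $ Some i ^ 2) * x $ Some i = \<mu>" for i
      using hess_radical_None[OF v0 x(2) rad, of i c, folded s_def]
      by (simp add: p eta vc \<mu>_def power_divide algebra_simps eta_mult[OF eta])
    define z where "z = (s * \<eta> / 3 - \<mu>) * 3 / 4"
    have z: "x $ Some i = z" if "i \<noteq> c" for i
      using rad[of i] vi[OF that] by (simp add: z_def power_divide eta algebra_simps eta_mult[OF eta])
    have "4 * z + x $ Some c = 0"
      using x by (simp add: hyperplane_def sum z add.commute)
    moreover have "3 * s = 4 * \<eta> * z - \<eta> * x $ Some c"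
      unfolding s_def by (simp add: sum z vi vc)
    moreover have "4 * z = s * \<eta> - 3 * \<mu>" "3 * \<mu> = 8 * x $ Some c - s * \<eta>"
      by (simp_all add: z_def \<mu>_def field_simps)
    ultimately have "z = 0" "x $ Some c = 0"
      using eta by algebra+
    then have "x $ Some i = 0" for i using z by (cases "i = c") auto
    then show ?thesis using x(2) by (simp add: coords_eq_iff)
  qed
  then show ?thesis
    using nodes_I[OF eta hyp cubic, of None] v0 by (simp add: E_point_def v_def)
qed

lemma T_point_node:
  assumes eta: "\<eta> ^ 2 = -3" and "p \<noteq> q"
  shows "T_point p q \<in> nodes \<eta>"
proof -
  define v where "v = hcoords 0 (\<lambda>i. if i = p then 1 else if i = q then -1 else 0)"
  have v0: "v $ None = 0" and vi: "i \<noteq> p \<Longrightarrow> i \<noteq> q \<Longrightarrow> v $ Some i = 0"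
    and vp: "v $ Some p = 1" and vq: "v $ Some q = -1" for i
    using \<open>p \<noteq> q\<close> by (auto simp: v_def)
  have sum: "(\<Sum>i\<in>UNIV. f i) = f p + f q + (\<Sum>i\<in>UNIV - {p, q}. f i)" for f :: "5 \<Rightarrow> complex"
    using \<open>p \<noteq> q\<close> by (simp add: sum.remove[of _ p] sum.remove[of _ q] Diff_insert2[symmetric] add_ac insert_commute)
  \<comment> \<open>For \<open>r = 0\<close> the three zero coordinates would contribute as well,
    since \<open>0 ^ 0 = 1\<close>.\<close>
  have p: "psum r v = 1 + (- 1) ^ r" if "r > 0" for r
    using that by (simp add: psum_def sum vi vp vq)
  have hyp: "v \<in> hyperplane \<eta>" by (simp add: hyperplane_iff_psum p v0)
  have cubic: "node_cubic \<eta> v (v $ Some i) = 0" for i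
    by (cases "i = p"; cases "i = q") (auto simp: node_cubic_def p v0 vi vp vq)
  have "x = 0" if x: "x \<in> hyperplane \<eta>" "x $ Some p = 0"
    and rad: "\<forall>y\<in>hyperplane \<eta>. y $ Some p = 0 \<longrightarrow> quartic_hess \<eta> v x y = 0" for x
  proof -
    define b where "b = x $ None"
    have s: "(\<Sum>i\<in>UNIV. v $ Some i * x $ Some i) = - x $ Some q"
      "(\<Sum>i\<in>UNIV. v $ Some i ^ 2 * x $ Some i) = x $ Some q"
      by (simp_all add: sum vi vp vq x(2))
    have "psum 2 v = 2" by (simp add: p)
    note rad = hess_radical_Some[OF v0 x this rad, unfolded s, folded b_def]
    \<comment> \<open>The radical condition at an index outside \<open>p\<close> and
      \<open>q\<close> reads \<open>b + \<eta> * x $ Some q + \<eta> * x $ Some i = 0\<close>;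
      \<open>z\<close> is its solution.\<close>
    define z where "z = - b / \<eta> - x $ Some q"
    have "\<eta> \<noteq> 0" using eta by auto
    have z: "x $ Some i = z" if "i \<noteq> p" "i \<noteq> q" for i
      using rad[of i] vi that \<open>\<eta> \<noteq> 0\<close> by (simp add: z_def field_simps add_eq_0_iff)
    have "b + \<eta> * x $ Some q + \<eta> * z = 0"
      using \<open>\<eta> \<noteq> 0\<close> by (simp add: z_def field_simps)
    \<comment> \<open>By \<open>\<eta> ^ 2 = -3\<close> this says \<open>- 2 * b = 0\<close>; then
      \<open>z = - x $ Some q\<close>, and the hyperplane equation finishes.\<close>
    moreover have "b + \<eta> * x $ Some q + \<eta> * (\<eta> * b - x $ Some q) = 0"
      using rad[of q] vq \<open>p \<noteq> q\<close> by (simp add: algebra_simps)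
    moreover have "card (UNIV - {p, q}) = 3"
      using \<open>p \<noteq> q\<close> by (simp add: card_Diff_subset)
    then have "x $ Some q + 3 * z = \<eta> * b"
      using x by (simp add: hyperplane_def sum z b_def)
    ultimately have "b = 0" "z = 0" "x $ Some q = 0"
      using eta by algebra+
    then have "x $ Some i = 0" for i using z x(2) by (cases "i = p"; cases "i = q") auto
    then show ?thesis using \<open>b = 0\<close> by (simp add: coords_eq_iff b_def)
  qed
  then show ?thesis
    using nodes_I[OF eta hyp cubic, of "Some p"] vp by (simp add: T_point_def v_def)
qed

lemma nodes_eq:
  assumes eta: "\<eta> ^ 2 = -3"
  shows "nodes \<eta> = R_nodes \<eta> \<union> T_nodes \<union> E_nodes \<eta>"
proof
  show "nodes \<eta> \<subseteq> R_nodes \<eta> \<union> T_nodes \<union> E_nodes \<eta>"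
  proof
    fix P assume "P \<in> nodes \<eta>"
    then obtain v where "P = proj_point v" "v \<noteq> 0" "ordinary_double_point quartic (hyperplane \<eta>) v"
      unfolding nodes_def proj_locus_def by blast
    then show "P \<in> R_nodes \<eta> \<union> T_nodes \<union> E_nodes \<eta>"
      using node_cubic_classification[OF eta, of v]
      unfolding ordinary_double_point_quartic[OF eta] by simp
  qed
  show "R_nodes \<eta> \<union> T_nodes \<union> E_nodes \<eta> \<subseteq> nodes \<eta>"
  proof (intro Un_least subsetI)
    show "P \<in> nodes \<eta>" if "P \<in> R_nodes \<eta>" for P
      using that R_point_node[OF eta] unfolding R_nodes_def by auto
    show "P \<in> nodes \<eta>" if "P \<in> T_nodes" for P
      using that T_point_node[OF eta] unfolding T_nodes_def by auto
    show "P \<in> nodes \<eta>" if "P \<in> E_nodes \<eta>" for P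
      using that E_point_node[OF eta] unfolding E_nodes_def by auto
  qed
qed

lemma nodes_subset: "nodes \<eta> \<subseteq> X_eta \<eta>"
  unfolding nodes_def X_eta_def proj_locus_def ordinary_double_point_def by blast

section \<open>Incidences with the Pascal planes\<close>

lemma mem_proj_point: "v \<in> proj_point w \<longleftrightarrow> (\<exists>t. v = t *s w)"
  by (auto simp: proj_point_def vec.span_singleton)

lemma proj_point_eq_iff: "proj_point v = proj_point w \<longleftrightarrow> (\<exists>t. t \<noteq> 0 \<and> w = t *s v)"
proof
  assume eq: "proj_point v = proj_point w"
  have "v \<in> proj_point v" "w \<in> proj_point w"
    by (simp_all add: proj_point_def vec.span_base)
  then have "v \<in> proj_point w" "w \<in> proj_point v"
    using eq by simp_all
  then obtain s t where s: "v = s *s w" and t: "w = t *s v"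
    unfolding mem_proj_point by (elim exE)
  show "\<exists>t. t \<noteq> 0 \<and> w = t *s v"
  \<comment> \<open>If \<open>t = 0\<close>, then \<open>w\<close> and hence
    \<open>v = s *s w\<close> are zero, so the scalar 1 works.\<close>
  proof (cases "t = 0")
    case True
    then have "w = 1 *s v" using s t by simp
    then show ?thesis by (intro exI[of _ 1]) simp
  qed (use t in blast)
qed (auto simp: proj_point_scale)

lemma proj_point_hcoords_1_eq_iff:
  "proj_point (hcoords 1 u) = proj_point (hcoords 1 w) \<longleftrightarrow> u = w"
proof
  assume "proj_point (hcoords 1 u) = proj_point (hcoords 1 w)"
  then obtain t where eq: "hcoords 1 w = t *s hcoords 1 u"
    unfolding proj_point_eq_iff by blast
  have "hcoords 1 w $ k = t * hcoords 1 u $ k" for k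
    unfolding eq by simp
  from this[of None] this[of "Some i" for i] show "u = w"
    by (simp add: fun_eq_iff)
qed simp

text \<open>Membership in a \<open>proj_locus\<close> provides only some representative satisfying
  the equations; these are homogeneous, so every representative may be tested.\<close>

lemma pascal_plane_iff:
  assumes "v \<noteq> 0"
  shows "proj_point v \<in> pascal_plane \<eta> i j \<longleftrightarrow>
    v \<in> hyperplane \<eta> \<and> v $ Some i = - v $ None \<and> v $ Some j = v $ None"
proof -
  have scale: "v \<in> hyperplane \<eta> \<and> v $ Some i = - v $ None \<and> v $ Some j = v $ None"
    if "w \<in> hyperplane \<eta>" "w $ Some i = - w $ None" "w $ Some j = w $ None" "v = t *s w" for w t
    using that(1-3) unfolding that(4) by (simp add: hyperplane_def flip: sum_distrib_left)
  have plane: "pascal_plane \<eta> i j = {proj_point w | w. w \<noteq> 0 \<and>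
      w \<in> hyperplane \<eta> \<and> w $ Some i = - w $ None \<and> w $ Some j = w $ None}"
  proof -
    have eqs: "a + b = 0 \<longleftrightarrow> b = - a" "a - b = 0 \<longleftrightarrow> b = a" for a b :: complex
      by (simp_all add: add_eq_0_iff eq_commute[of a b])
    show ?thesis unfolding pascal_plane_def proj_locus_def eqs by (rule refl)
  qed
  show ?thesis
  proof
    assume "proj_point v \<in> pascal_plane \<eta> i j"
    then obtain w where w: "proj_point w = proj_point v"
      "w \<in> hyperplane \<eta>" "w $ Some i = - w $ None" "w $ Some j = w $ None"
      unfolding plane by force
    then show "v \<in> hyperplane \<eta> \<and> v $ Some i = - v $ None \<and> v $ Some j = v $ None"
      using scale[OF w(2-4)] w(1) unfolding proj_point_eq_iff by blast
  qed (use assms plane in blast)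
qed

lemma hcoords_1_neq_0: "hcoords 1 u \<noteq> 0"
  by (metis hcoords_nth(1) one_neq_zero zero_index)

text \<open>Since \<open>\<eta>\<close> is neither 1 nor -1, the coordinate at \<open>c\<close> can
  satisfy neither plane equation.\<close>

lemma R_point_pascal:
  assumes eta: "\<eta> ^ 2 = -3" and AB: "card A = 2" "card B = 2" "A \<inter> B = {}"
    "c \<notin> A \<union> B" "A \<union> B \<union> {c} = UNIV"
  shows "R_point \<eta> A B \<in> pascal_plane \<eta> i j \<longleftrightarrow> i \<in> A \<and> j \<in> B"
proof -
  define v where "v = hcoords 1 (\<lambda>i. if i \<in> A then -1 else if i \<in> B then 1 else \<eta>)"
  have sum: "(\<Sum>i\<in>UNIV. f i) = (\<Sum>i\<in>A. f i) + (\<Sum>i\<in>B. f i) + f c" for f :: "5 \<Rightarrow> complex"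
    using AB(3,4) by (simp add: AB(5)[symmetric] sum.union_disjoint add_ac)
  have v0: "v $ None = 1" and vA: "i \<in> A \<Longrightarrow> v $ Some i = -1" and vB: "i \<in> B \<Longrightarrow> v $ Some i = 1"
    and vc: "v $ Some c = \<eta>" for i
    using AB by (auto simp: v_def)
  have "v \<in> hyperplane \<eta>" by (simp add: hyperplane_def sum v0 vA vB vc AB)
  moreover have "\<eta> \<noteq> 1" "\<eta> \<noteq> -1" using eta by auto
  then have "v $ Some i = -1 \<longleftrightarrow> i \<in> A" "v $ Some i = 1 \<longleftrightarrow> i \<in> B" for i
    using vA[of i] vB[of i] vc AB(3,5) by (cases "i \<in> A"; cases "i \<in> B"; force)+
  moreover have "v \<noteq> 0" unfolding v_def by (rule hcoords_1_neq_0)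
  ultimately have "proj_point v \<in> pascal_plane \<eta> i j \<longleftrightarrow> i \<in> A \<and> j \<in> B"
    by (simp add: pascal_plane_iff v0)
  then show ?thesis unfolding R_point_def v_def .
qed

text \<open>With \<open>a = 0\<close> the two plane equations say that the coordinates at
  \<open>i\<close> and \<open>j\<close> vanish.\<close>

lemma T_point_pascal:
  assumes "p \<noteq> q"
  shows "T_point p q \<in> pascal_plane \<eta> i j \<longleftrightarrow> i \<notin> {p, q} \<and> j \<notin> {p, q}"
proof -
  define v where "v = hcoords 0 (\<lambda>i. if i = p then 1 else if i = q then -1 else 0)"
  have "v \<in> hyperplane \<eta>"
    using sum_two[OF assms, of "\<lambda>_. 1"] by (simp add: hyperplane_def v_def)
  moreover have "v \<noteq> 0" by (auto simp: coords_eq_iff v_def intro!: exI[of _ p])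
  ultimately show ?thesis
    using pascal_plane_iff[of v \<eta> i j] by (simp add: T_point_def v_def)
qed

lemma E_point_pascal:
  assumes "\<eta> ^ 2 = -3" "i \<noteq> j"
  shows "E_point \<eta> c \<notin> pascal_plane \<eta> i j"
proof
  assume "E_point \<eta> c \<in> pascal_plane \<eta> i j"
  then have "(if i = c then - \<eta> / 3 else \<eta> / 3) = - 1" "(if j = c then - \<eta> / 3 else \<eta> / 3) = 1"
    unfolding E_point_def pascal_plane_iff[OF hcoords_1_neq_0] by simp_all
  then have "\<eta> = 3 \<or> \<eta> = -3" by (auto split: if_splits simp: field_simps)
  then show False using assms(1) by auto
qed

lemma pascal_plane_inj:
  assumes "\<eta> ^ 2 = -3" "i \<noteq> j" "pascal_plane \<eta> i j = pascal_plane \<eta> k l"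
  shows "i = k \<and> j = l"
proof -
  \<comment> \<open>A point of the plane that takes the value -1 only at \<open>i\<close> and 1 only
    at \<open>j\<close>, so it reveals both indices. The value \<open>\<eta> / 3\<close> at the
    other three makes the coordinates sum to \<open>\<eta>\<close>.\<close>
  define v where "v = hcoords 1 (\<lambda>m. if m = i then -1 else if m = j then 1 else \<eta> / 3)"
  have "(\<Sum>m\<in>UNIV. v $ Some m) = (\<Sum>m\<in>{i, j}. v $ Some m) + (\<Sum>m\<in>UNIV - {i, j}. v $ Some m)"
    by (subst sum.subset_diff[of "{i, j}"]) auto
  also have "(\<Sum>m\<in>UNIV - {i, j}. v $ Some m) = (\<Sum>m\<in>UNIV - {i, j}. \<eta> / 3)"
    by (intro sum.cong) (auto simp: v_def)
  finally have "v \<in> hyperplane \<eta>"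
    using assms(2) by (simp add: hyperplane_def v_def card_Diff_subset)
  then have "proj_point v \<in> pascal_plane \<eta> i j"
    unfolding v_def pascal_plane_iff[OF hcoords_1_neq_0] using assms(2) by simp
  then have "proj_point v \<in> pascal_plane \<eta> k l" using assms(3) by simp
  then have "v $ Some k = -1" "v $ Some l = 1"
    unfolding v_def pascal_plane_iff[OF hcoords_1_neq_0] by simp_all
  moreover have "\<eta> / 3 \<noteq> 1" "\<eta> / 3 \<noteq> -1"
    using assms(1) by (auto simp: field_simps)
  ultimately show ?thesis
    by (auto simp: v_def split: if_splits)
qed

text \<open>Turns counting planes into counting ordered pairs of indices. A general \<open>Q\<close>
  covers both the planes through a point and all planes.\<close>

lemma card_pascal_planes_through:
  assumes "\<eta> ^ 2 = -3"
  shows "card {P \<in> pascal_planes \<eta>. Q P} = card {(i, j). i \<noteq> j \<and> Q (pascal_plane \<eta> i j)}"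
proof -
  let ?f = "\<lambda>(i, j). pascal_plane \<eta> i j"
  have "{P \<in> pascal_planes \<eta>. Q P} = ?f ` {(i, j). i \<noteq> j \<and> Q (pascal_plane \<eta> i j)}"
    unfolding pascal_planes_def by auto
  moreover have "inj_on ?f {(i, j). i \<noteq> j \<and> Q (pascal_plane \<eta> i j)}"
  proof (rule inj_onI, clarify)
    fix i j k l assume "i \<noteq> j" "pascal_plane \<eta> i j = pascal_plane \<eta> k l"
    then show "i = k \<and> j = l" by (rule pascal_plane_inj[OF assms])
  qed
  ultimately show ?thesis by (simp only: card_image)
qed

section \<open>Counting the nodes and the nodes on a plane\<close>

lemma card_Compl_5: "card (- A) = 5 - card (A :: 5 set)"
  by (simp add: Compl_eq_Diff_UNIV card_Diff_subset)

lemma card_off_diagonal: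
  assumes "finite A"
  shows "card {(i, j). i \<in> A \<and> j \<in> A \<and> i \<noteq> j} = card A * (card A - 1)"
proof -
  have "{(i, j). i \<in> A \<and> j \<in> A \<and> i \<noteq> j} = (SIGMA i:A. A - {i})" by auto
  then show ?thesis using assms by simp
qed

lemma R_point_inj:
  assumes eta: "\<eta> ^ 2 = -3" and "A \<inter> B = {}" "C \<inter> D = {}" "R_point \<eta> A B = R_point \<eta> C D"
  shows "A = C \<and> B = D"
proof -
  have "(\<lambda>i. if i \<in> A then -1 else if i \<in> B then 1 else \<eta>) = (\<lambda>i. if i \<in> C then -1 else if i \<in> D then 1 else \<eta>)"
    using assms(4) unfolding R_point_def proj_point_hcoords_1_eq_iff .
  then have eq: "(if i \<in> A then -1 else if i \<in> B then 1 else \<eta>) = (if i \<in> C then -1 else if i \<in> D then 1 else \<eta>)" for i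
    by (rule fun_cong)
  have "\<eta> \<noteq> 1" "\<eta> \<noteq> -1" using eta by auto
  then have "(i \<in> A \<longleftrightarrow> i \<in> C) \<and> (i \<in> B \<longleftrightarrow> i \<in> D)" for i
    using eq[of i] assms(2,3) by (auto split: if_splits)
  then show ?thesis by blast
qed

text \<open>The index \<open>c\<close> is left out because it is the only element outside
  \<open>A\<close> and \<open>B\<close>; the pairs thus parametrise the points
  \<open>R_point\<close> without repetition.\<close>

definition disjoint_pairs :: "(5 set \<times> 5 set) set" where
  "disjoint_pairs = {(A, B). card A = 2 \<and> card B = 2 \<and> A \<inter> B = {}}"

lemma disjoint_pairs_rest:
  assumes "card A = 2" "card B = 2" "A \<inter> B = {}"
  obtains c :: 5 where "c \<notin> A \<union> B" "A \<union> B \<union> {c} = UNIV"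
proof -
  have "card (A \<union> B) = 4" using assms by (simp add: card_Un_disjoint)
  then have "card (UNIV - (A \<union> B)) = 1" by (simp add: card_Diff_subset)
  then obtain c where "UNIV - (A \<union> B) = {c}" using card_1_singletonE by blast
  then show ?thesis using that by blast
qed

lemma R_nodes_image: "R_nodes \<eta> = (\<lambda>(A, B). R_point \<eta> A B) ` disjoint_pairs"
proof
  show "R_nodes \<eta> \<subseteq> (\<lambda>(A, B). R_point \<eta> A B) ` disjoint_pairs"
    unfolding R_nodes_def disjoint_pairs_def by auto
  show "(\<lambda>(A, B). R_point \<eta> A B) ` disjoint_pairs \<subseteq> R_nodes \<eta>"
  proof clarify
    fix A B assume "(A, B) \<in> disjoint_pairs"
    then have AB: "card A = 2" "card B = 2" "A \<inter> B = {}" by (simp_all add: disjoint_pairs_def)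
    obtain c where "c \<notin> A \<union> B" "A \<union> B \<union> {c} = UNIV" using disjoint_pairs_rest[OF AB] .
    with AB show "R_point \<eta> A B \<in> R_nodes \<eta>" unfolding R_nodes_def by blast
  qed
qed

lemma inj_on_R_point:
  assumes "\<eta> ^ 2 = -3"
  shows "inj_on (\<lambda>(A, B). R_point \<eta> A B) disjoint_pairs"
proof (rule inj_onI, clarify)
  fix A B C D
  assume "(A, B) \<in> disjoint_pairs" "(C, D) \<in> disjoint_pairs" "R_point \<eta> A B = R_point \<eta> C D"
  then show "A = C \<and> B = D"
    by (intro R_point_inj[OF assms]) (simp_all add: disjoint_pairs_def)
qed

text \<open>Ten choices for \<open>A\<close>, then three for \<open>B\<close> inside the
  three-element complement.\<close>

lemma card_disjoint_pairs: "card disjoint_pairs = 30"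
proof -
  have pairs: "disjoint_pairs = (SIGMA A:{A. card A = 2}. {B. B \<subseteq> - A \<and> card B = 2})"
    by (auto simp: disjoint_pairs_def set_eq_iff)
  have "card {B. B \<subseteq> - A \<and> card B = 2} = 3" if "card A = 2" for A :: "5 set"
    using that by (simp add: n_subsets card_Compl_5 choose_two)
  then have "card disjoint_pairs = (\<Sum>A::5 set | card A = 2. 3)"
    unfolding pairs by (subst card_SigmaI) (auto intro!: sum.cong)
  also have "\<dots> = 30"
    using n_subsets[of "UNIV :: 5 set" 2] by (simp add: choose_two)
  finally show ?thesis .
qed

text \<open>The partners of \<open>i\<close> in \<open>A\<close> and of \<open>j\<close> in
  \<open>B\<close> are two distinct elements of the remaining three, in order: 3 * 2
  choices.\<close>

lemma card_disjoint_pairs_through: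
  assumes "i \<noteq> j"
  shows "card {(A, B) \<in> disjoint_pairs. i \<in> A \<and> j \<in> B} = 6"
proof -
  let ?f = "\<lambda>(k, l). ({i, k}, {j, l})"
  let ?K = "{(k, l). k \<in> - {i, j} \<and> l \<in> - {i, j} \<and> k \<noteq> l}"
  have "{(A, B) \<in> disjoint_pairs. i \<in> A \<and> j \<in> B} = ?f ` ?K"
  proof
    show "{(A, B) \<in> disjoint_pairs. i \<in> A \<and> j \<in> B} \<subseteq> ?f ` ?K"
    proof clarify
      fix A B assume AB: "(A, B) \<in> disjoint_pairs" "i \<in> A" "j \<in> B"
      then obtain k l where "A = {i, k}" "B = {j, l}" "i \<noteq> k" "j \<noteq> l"
        unfolding disjoint_pairs_def by (auto simp: card_2_iff)
      then show "(A, B) \<in> ?f ` ?K"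
        using AB unfolding disjoint_pairs_def by auto
    qed
    show "?f ` ?K \<subseteq> {(A, B) \<in> disjoint_pairs. i \<in> A \<and> j \<in> B}"
      using assms unfolding disjoint_pairs_def by auto
  qed
  moreover have "inj_on ?f ?K"
    by (auto simp: inj_on_def doubleton_eq_iff)
  moreover have "card ?K = 6"
    using assms by (subst card_off_diagonal) (simp_all add: card_Compl_5)
  ultimately show ?thesis by (simp only: card_image)
qed

text \<open>\<open>T_point p q\<close> depends only on \<open>{p, q}\<close>, which is recovered as the support of the point.\<close>

definition support :: "coords set \<Rightarrow> 5 set" where
  "support P = {i. \<exists>v\<in>P. v $ Some i \<noteq> 0}"

lemma support_T_point: "support (T_point p q) = {p, q}"
proof -
  have "T_point p q = range (\<lambda>t. t *s hcoords 0 (\<lambda>i. if i = p then 1 else if i = q then -1 else 0))"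
    by (simp add: T_point_def proj_point_def vec.span_singleton)
  then show ?thesis by (auto simp: support_def intro!: exI[of _ 1])
qed

lemma T_point_commute: "T_point p q = T_point q p"
proof (cases "p = q")
  case False
  then have "hcoords 0 (\<lambda>i. if i = p then 1 else if i = q then -1 else 0) =
      -1 *s hcoords 0 (\<lambda>i. if i = q then 1 else if i = p then -1 else 0)"
    by (auto simp: coords_eq_iff)
  then show ?thesis
    unfolding T_point_def using proj_point_scale[of "-1"] by simp
qed simp

lemma inj_on_support: "inj_on support T_nodes"
proof (rule inj_onI)
  fix P Q assume "P \<in> T_nodes" "Q \<in> T_nodes" "support P = support Q"
  then obtain p q p' q' where "P = T_point p q" "Q = T_point p' q'" "{p, q} = {p', q'}"
    unfolding T_nodes_def by (auto simp: support_T_point)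
  then show "P = Q" using T_point_commute by (auto simp: doubleton_eq_iff)
qed

text \<open>Used twice: \<open>S = UNIV\<close> counts all these nodes, and
  \<open>S = - {i, j}\<close> those on a given plane.\<close>

lemma card_T_nodes: "card {P \<in> T_nodes. support P \<subseteq> S} = card S choose 2"
proof -
  have "support ` {P \<in> T_nodes. support P \<subseteq> S} = {C. C \<subseteq> S \<and> card C = 2}"
  proof (intro equalityI subsetI)
    fix C assume "C \<in> {C. C \<subseteq> S \<and> card C = 2}"
    then obtain p q where "C = {p, q}" "p \<noteq> q" "C \<subseteq> S" by (auto simp: card_2_iff)
    then show "C \<in> support ` {P \<in> T_nodes. support P \<subseteq> S}"
      by (intro image_eqI[of _ _ "T_point p q"]) (auto simp: support_T_point T_nodes_def)
  qed (auto simp: support_T_point T_nodes_def)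
  moreover have "inj_on support {P \<in> T_nodes. support P \<subseteq> S}"
    using inj_on_support by (rule inj_on_subset) auto
  ultimately have "card {P \<in> T_nodes. support P \<subseteq> S} = card {C. C \<subseteq> S \<and> card C = 2}"
    by (simp flip: card_image)
  then show ?thesis by (simp add: n_subsets)
qed

lemma hcoords_1_notin_T_nodes: "proj_point (hcoords 1 u) \<notin> T_nodes"
proof
  assume "proj_point (hcoords 1 u) \<in> T_nodes"
  then obtain p q t where "t \<noteq> 0"
    "hcoords 0 (\<lambda>i. if i = p then 1 else if i = q then -1 else 0) = t *s hcoords 1 u"
    unfolding T_nodes_def T_point_def proj_point_eq_iff mem_Collect_eq by blast
  from arg_cong[OF this(2), of "\<lambda>v. v $ None"] this(1) show False by simp
qed

lemma R_E_disjoint: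
  assumes "\<eta> ^ 2 = -3"
  shows "R_nodes \<eta> \<inter> E_nodes \<eta> = {}"
proof -
  have "R_point \<eta> A B \<noteq> E_point \<eta> c" if AB: "card A = 2" for A B c
  proof
    assume "R_point \<eta> A B = E_point \<eta> c"
    then have eq: "(\<lambda>i. if i \<in> A then -1 else if i \<in> B then 1 else \<eta>) = (\<lambda>i. if i = c then - \<eta> / 3 else \<eta> / 3)"
      unfolding R_point_def E_point_def proj_point_hcoords_1_eq_iff .
    obtain i where "i \<in> A" using AB by fastforce
    then have "\<eta> / 3 = -1 \<or> \<eta> / 3 = 1"
      using fun_cong[OF eq, of i] by (auto split: if_splits simp: field_simps)
    then have "\<eta> = -3 \<or> \<eta> = 3" by (auto simp: field_simps)
    then show False using assms by auto
  qed
  then show ?thesis unfolding R_nodes_def E_nodes_def by blast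
qed

lemma card_E_nodes:
  assumes "\<eta> ^ 2 = -3"
  shows "card (E_nodes \<eta>) = 5"
proof -
  have "inj (E_point \<eta>)"
  proof (rule injI)
    fix c d assume "E_point \<eta> c = E_point \<eta> d"
    then have eq: "(\<lambda>i. if i = c then - \<eta> / 3 else \<eta> / 3) = (\<lambda>i. if i = d then - \<eta> / 3 else \<eta> / 3)"
      unfolding E_point_def proj_point_hcoords_1_eq_iff .
    show "c = d"
    proof (rule ccontr)
      assume "c \<noteq> d"
      then have "- \<eta> / 3 = \<eta> / 3"
        using fun_cong[OF eq, of c] by (simp only: if_True if_False refl)
      then have "\<eta> = 0" by algebra
      then show False using assms by simp
    qed
  qed
  then show ?thesis unfolding E_nodes_def by (simp add: card_image)
qed

theorem proposition5p1:
  fixes \<eta> :: complex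
  assumes "\<eta> ^ 2 = -3"
  shows "nodes \<eta> = R_nodes \<eta> \<union> T_nodes \<union> E_nodes \<eta> \<and>
      nodes \<eta> \<subseteq> X_eta \<eta> \<and>
      card (nodes \<eta>) = 45 \<and>
      card (pascal_planes \<eta>) = 20 \<and>
      card (R_nodes \<eta>) = 30 \<and>
      (\<forall>p\<in>R_nodes \<eta>. card {P \<in> pascal_planes \<eta>. p \<in> P} = 4) \<and>
      card T_nodes = 10 \<and>
      (\<forall>p\<in>T_nodes. card {P \<in> pascal_planes \<eta>. p \<in> P} = 6) \<and>
      card (E_nodes \<eta>) = 5 \<and>
      (\<forall>p\<in>E_nodes \<eta>. card {P \<in> pascal_planes \<eta>. p \<in> P} = 0) \<and>
      (\<forall>P\<in>pascal_planes \<eta>. card (P \<inter> nodes \<eta>) = 9)"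
proof (intro conjI ballI)
  show nodes: "nodes \<eta> = R_nodes \<eta> \<union> T_nodes \<union> E_nodes \<eta>" by (rule nodes_eq[OF assms])
  show "nodes \<eta> \<subseteq> X_eta \<eta>" by (rule nodes_subset)
  show R: "card (R_nodes \<eta>) = 30"
    unfolding R_nodes_image card_image[OF inj_on_R_point[OF assms]] by (rule card_disjoint_pairs)
  show T: "card T_nodes = 10"
    using card_T_nodes[of UNIV] by (simp add: choose_two)
  show E: "card (E_nodes \<eta>) = 5" by (rule card_E_nodes[OF assms])
  have RT: "R_nodes \<eta> \<inter> T_nodes = {}" and ET: "E_nodes \<eta> \<inter> T_nodes = {}"
    unfolding R_nodes_def R_point_def E_nodes_def E_point_def using hcoords_1_notin_T_nodes by auto
  have fin: "finite (R_nodes \<eta>)" "finite T_nodes" "finite (E_nodes \<eta>)"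
    using R T E by (auto intro: card_ge_0_finite)
  show "card (nodes \<eta>) = 45"
    unfolding nodes using RT ET R_E_disjoint[OF assms] R T E fin
    by (subst card_Un_disjoint; (subst card_Un_disjoint)?) auto
  show "card (pascal_planes \<eta>) = 20"
    using card_pascal_planes_through[OF assms, of "\<lambda>_. True"] card_off_diagonal[of "UNIV :: 5 set"] by simp
  show "card {P \<in> pascal_planes \<eta>. p \<in> P} = 4" if p: "p \<in> R_nodes \<eta>" for p
  proof -
    obtain A B c where AB: "p = R_point \<eta> A B" "card A = 2" "card B = 2" "A \<inter> B = {}"
      "c \<notin> A \<union> B" "A \<union> B \<union> {c} = UNIV"
      using p unfolding R_nodes_def by blast
    \<comment> \<open>Disjointness of \<open>A\<close> and \<open>B\<close> makes
      \<open>i \<noteq> j\<close> automatic, so the count is 2 * 2.\<close>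
    have "{(i, j). i \<noteq> j \<and> p \<in> pascal_plane \<eta> i j} = A \<times> B"
      using AB(4) unfolding AB(1) R_point_pascal[OF assms AB(2-6)] by auto
    then show ?thesis
      using AB(2,3) by (simp add: card_pascal_planes_through[OF assms])
  qed
  show "card {P \<in> pascal_planes \<eta>. p \<in> P} = 6" if p: "p \<in> T_nodes" for p
  proof -
    obtain k l where kl: "p = T_point k l" "k \<noteq> l"
      using p unfolding T_nodes_def by blast
    have "{(i, j). i \<noteq> j \<and> p \<in> pascal_plane \<eta> i j} = {(i, j). i \<in> - {k, l} \<and> j \<in> - {k, l} \<and> i \<noteq> j}"
      unfolding kl(1) T_point_pascal[OF kl(2)] by auto
    then show ?thesis
      using kl(2) by (simp only: card_pascal_planes_through[OF assms] card_off_diagonal finite) (simp add: card_Compl_5)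
  qed
  show "card {P \<in> pascal_planes \<eta>. p \<in> P} = 0" if "p \<in> E_nodes \<eta>" for p
  proof -
    have "{P \<in> pascal_planes \<eta>. p \<in> P} = {}"
      using that E_point_pascal[OF assms] unfolding E_nodes_def pascal_planes_def by blast
    then show ?thesis by (simp only: card.empty)
  qed
  show "card (P \<inter> nodes \<eta>) = 9" if P: "P \<in> pascal_planes \<eta>" for P
  proof -
    obtain i j where P: "P = pascal_plane \<eta> i j" "i \<noteq> j"
      using P unfolding pascal_planes_def by blast
    let ?D = "{(A, B) \<in> disjoint_pairs. i \<in> A \<and> j \<in> B}"
    have "R_point \<eta> A B \<in> P \<longleftrightarrow> i \<in> A \<and> j \<in> B" if "(A, B) \<in> disjoint_pairs" for A B
    proof -
      have AB: "card A = 2" "card B = 2" "A \<inter> B = {}"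
        using that by (simp_all add: disjoint_pairs_def)
      then obtain c where "c \<notin> A \<union> B" "A \<union> B \<union> {c} = UNIV"
        using disjoint_pairs_rest by blast
      then show ?thesis unfolding P(1) by (rule R_point_pascal[OF assms AB])
    qed
    then have "P \<inter> R_nodes \<eta> = (\<lambda>(A, B). R_point \<eta> A B) ` ?D"
      unfolding R_nodes_image by auto
    moreover have "inj_on (\<lambda>(A, B). R_point \<eta> A B) ?D"
      using inj_on_R_point[OF assms] by (rule inj_on_subset) auto
    ultimately have PR: "card (P \<inter> R_nodes \<eta>) = 6"
      by (simp add: card_image card_disjoint_pairs_through[OF P(2)])
    have "P \<inter> T_nodes = {Q \<in> T_nodes. support Q \<subseteq> - {i, j}}"
      unfolding P(1) T_nodes_def by (auto simp: T_point_pascal support_T_point)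
    then have PT: "card (P \<inter> T_nodes) = 3"
      using P(2) by (simp only: card_T_nodes) (simp add: card_Compl_5 choose_two)
    have "P \<inter> nodes \<eta> = (P \<inter> R_nodes \<eta>) \<union> (P \<inter> T_nodes)"
      using E_point_pascal[OF assms P(2)] unfolding nodes P(1) E_nodes_def by blast
    \<comment> \<open>No \<open>E_point\<close> lies on the plane, so only the other two types
      contribute.\<close>
    moreover have "card ((P \<inter> R_nodes \<eta>) \<union> (P \<inter> T_nodes)) = 6 + 3"
      using RT fin PR PT by (subst card_Un_disjoint) auto
    ultimately show ?thesis by simp
  qed
qed

end
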